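(* For every integer $d\ge0$, the normalized volume of the $d$-th Laplacian polytope $P_{\partial(\sigma_{d+1})}$ of the boundary of the $(d+1)$-simplex is $(d+2)^d$.
   Context: Let $\sigma_{d+1}=2^{[d+2]}$ be the full simplex on vertex set $[d+2]=\{1<2<\dots<d+2\}$ and $\partial(\sigma_{d+1})=\sigma_{d+1}\setminus\{[d+2]\}$ its boundary, a $d$-dimensional simplicial complex. For a simplicial complex $\Delta$ on an ordered vertex set, $C_i(\Delta)$ is the $\mathbb{Q}$-vector space with basis $e_\sigma$, $\sigma$ an $i$-dimensional face, with $C_i(\Delta)=0$ for $i\le -1$ and $i>\dim\Delta$; the boundary map $\partial_i:C_i(\Delta)\to C_{i-1}(\Delta)$ is $\partial_i(e_\sigma)=\sum_{k=1}^{i+1}(-1)^{k-1}e_{\sigma\setminus\{j_k\}}$ for $\sigma=\{j_1<\dots<j_{i+1}\}$ (so $\partial_0=0$). The $i$-th Laplacian matrix is $\mathcal{L}_i(\Delta)=\partial_{i+1}\partial_{i+1}^{\top}+\partial_i^{\top}\partial_i$. For $\Delta=\partial(\sigma_{d+1})$ the rows and columns of $\mathcal{L}_d(\Delta)\in\mathbb{Z}^{(d+2)\times(d+2)}$ are ordered according to the facets $F_1,\dots,F_{d+2}$, where $F_i=[d+2]\setminus\{d+3-i\}$. Then $P_{\partial(\sigma_{d+1})}\subseteq\mathbb{R}^{d+2}$ is the convex hull of the columns of $\mathcal{L}_d(\partial(\sigma_{d+1}))$. The normalized volume of a full-dimensional lattice polytope $P\subseteq\mathbb{R}^D$ is $D!\cdot\mathrm{vol}(P)$.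 For a lattice polytope that is not full-dimensional, it is taken with respect to the lattice $\mathrm{aff}(P)\cap\mathbb{Z}^{m}$, i.e. it is computed after identifying this affine lattice with $\mathbb{Z}^{D}$, $D=\dim P$, by an affine lattice isomorphism; a single point has normalized volume $1$. *)

theory Defs
  imports "HOL-Analysis.Analysis"
begin

definition std_simplex :: "nat \<Rightarrow> nat set set" where
  "std_simplex n = Pow {1..n + 1}"

definition std_simplex_boundary :: "nat \<Rightarrow> nat set set" where
  "std_simplex_boundary n = std_simplex n - {{1..n + 1}}"

(* Complexes contain the empty face, but it is not counted as a face of dimension -1: the chain
   complex is unreduced, with C_i = 0 for i <= -1. *)
definition faces :: "nat set set \<Rightarrow> int \<Rightarrow> nat set set" where
  "faces \<Delta> i = {\<sigma> \<in> \<Delta>. 0 \<le> i \<and> int (card \<sigma>) = i + 1}"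

(* The coefficient of e_\<tau> in the boundary of e_\<sigma>, for \<sigma> = {j_1 < ... < j_m}; the list index k - 1
   picks j_k.  Matrices over chain bases are functions of two faces, and the chain groups enter
   only through the face sets over which products are summed.  In particular the boundary map
   from degree 0 vanishes because faces \<Delta> (-1) is empty. *)
definition boundary_coeff :: "nat set \<Rightarrow> nat set \<Rightarrow> int" where
  "boundary_coeff \<tau> \<sigma> =
     (\<Sum>k = 1..card \<sigma>. if \<tau> = \<sigma> - {sorted_list_of_set \<sigma> ! (k - 1)} then (- 1) ^ (k - 1) else 0)"

(* Entries of \<partial>_{i+1} \<partial>_{i+1}^T + \<partial>_i^T \<partial>_i.  They are integers, so the rational coefficients of the
   chain spaces play no role. *)
definition laplacian :: "nat set set \<Rightarrow> int \<Rightarrow> nat set \<Rightarrow> nat set \<Rightarrow> int" where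
  "laplacian \<Delta> i \<sigma> \<sigma>' =
     (\<Sum>\<rho>\<in>faces \<Delta> (i + 1). boundary_coeff \<sigma> \<rho> * boundary_coeff \<sigma>' \<rho>)
   + (\<Sum>\<rho>\<in>faces \<Delta> (i - 1). boundary_coeff \<rho> \<sigma> * boundary_coeff \<rho> \<sigma>')"

(* F lists the i-dimensional faces of \<Delta>; it fixes the order of rows and columns. *)
definition laplacian_matrix ::
    "nat set set \<Rightarrow> int \<Rightarrow> ('n::finite \<Rightarrow> nat set) \<Rightarrow> real ^ 'n ^ 'n" where
  "laplacian_matrix \<Delta> i F = (\<chi> r c. of_int (laplacian \<Delta> i (F r) (F c)))"

definition laplacian_polytope ::
    "nat set set \<Rightarrow> int \<Rightarrow> ('n::finite \<Rightarrow> nat set) \<Rightarrow> (real ^ 'n) set" where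
  "laplacian_polytope \<Delta> i F = convex hull (columns (laplacian_matrix \<Delta> i F))"

definition boundary_facet :: "nat \<Rightarrow> nat \<Rightarrow> nat set" where
  "boundary_facet d i = {1..d + 2} - {d + 3 - i}"

definition integer_points :: "(real ^ 'n::finite) set" where
  "integer_points = {x. \<forall>i. x $ i \<in> \<int>}"

(* R^D for varying D is modelled by the extensional functions {..<D} \<rightarrow>\<^sub>E UNIV. *)
definition affine_chart :: "nat \<Rightarrow> real ^ 'n \<Rightarrow> (nat \<Rightarrow> real ^ 'n) \<Rightarrow> (nat \<Rightarrow> real) \<Rightarrow> real ^ 'n::finite"
  where "affine_chart D p b x = p + (\<Sum>i<D. x i *\<^sub>R b i)"

definition affine_lattice_iso ::
    "nat \<Rightarrow> real ^ 'n \<Rightarrow> (nat \<Rightarrow> real ^ 'n) \<Rightarrow> (real ^ 'n::finite) set \<Rightarrow> bool" where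
  "affine_lattice_iso D p b L \<longleftrightarrow> bij_betw (affine_chart D p b) ({..<D} \<rightarrow>\<^sub>E \<int>) L"

(* For a nonempty lattice polytope an affine isomorphism from Z^D to the integer points of its
   affine hull exists, and two of them differ by a unimodular affine map, so the value does not
   depend on the one chosen.  For D = 0 the product measure is the unit point mass, so a single
   lattice point has normalized volume 1. *)
definition normalized_volume :: "(real ^ 'n::finite) set \<Rightarrow> real" where
  "normalized_volume P =
     (let D = nat (aff_dim P);
          (p, b) = (SOME (p, b). affine_lattice_iso D p b (affine hull P \<inter> integer_points))
      in fact D * measure (\<Pi>\<^sub>M i\<in>{..<D}. lborel)
           {x \<in> {..<D} \<rightarrow>\<^sub>E UNIV. affine_chart D p b x \<in> P})"

end

theory Submission
  imports Defs
begin

text \<open>Write \<open>n = d + 2\<close> and let \<open>s\<close> be the vector of signs \<open>(- 1)\<^sup>a\<close>, where \<open>a\<close> is the vertex missing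
  from a facet.  For \<open>d > 0\<close> the Laplacian is \<open>n I - s s\<^sup>T\<close>.  If \<open>n\<close> is odd, its columns \<open>v\<^sub>j\<close> are the
  vertices of a simplex spanning the hyperplane \<open>s \<bullet> x = 0\<close>.  If \<open>n\<close> is even, they lie in codimension
  two and form a circuit with \<open>n / 2\<close> positive and \<open>n / 2\<close> negative elements, so the polytope is
  triangulated by the \<open>n / 2\<close> simplices omitting one positive vertex.  Every volume is read off from
  the determinant of a matrix that consists of differences \<open>v\<^sub>c - v\<^sub>j\<close> and of unit vectors: the simplex
  has normalized volume \<open>n\<^bsup>n-2\<^esup>\<close> in the odd case, and each of the \<open>n / 2\<close> simplices has
  \<open>2 n\<^bsup>n-3\<^esup>\<close> in the even case.  For \<open>d = 0\<close> the Laplacian vanishes, because \<open>C\<^sub>-\<^sub>1 = 0\<close>.\<close>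

subsection \<open>Lebesgue measure and linear maps\<close>

lemma det_shear:
  fixes m k :: "'n::finite"
  assumes "m \<noteq> k"
  shows "det (matrix (\<lambda>v::real^'n. \<chi> i. if i = m then v $ m + v $ k else v $ i)) = 1"
proof -
  have "matrix (\<lambda>v::real^'n. \<chi> i. if i = m then v $ m + v $ k else v $ i)
      = (\<chi> i. if i = m then row m (mat 1) + 1 *s row k (mat 1) else row i (mat 1))"
    by (auto simp: matrix_def row_def mat_def axis_def vec_eq_iff)
  then show ?thesis
    using det_row_operation[OF assms, where c = 1 and A = "mat 1 :: real^'n^'n"] by simp
qed

lemma measure_shear_cbox:
  fixes a b :: "real^'n::finite"
  assumes "m \<noteq> k"
  shows "measure lebesgue ((\<lambda>v. \<chi> i. if i = m then v $ m + v $ k else v $ i) ` cbox a b)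
       = measure lebesgue (cbox a b)"
proof (cases "cbox a b = {}")
  case False
  let ?h = "\<lambda>v::real^'n. \<chi> i. if i = m then v $ m + v $ k else v $ i"
  \<comment> \<open>\<open>measure_shear_interval\<close> asks for a nonnegative lower bound in
    coordinate \<open>k\<close>. Translating by \<open>c\<close> makes that bound 0, and by
    linearity the image of the box is translated as well.\<close>
  define c where "c = - axis k (a $ k)"
  have lin: "linear ?h"
    by (rule linearI) (auto simp: vec_eq_iff algebra_simps)
  have "cbox (c + a) (c + b) \<noteq> {}" "0 \<le> (c + a) $ k"
    using False by (auto simp: c_def interval_ne_empty_cart)
  note shear = measure_shear_interval[OF assms this]
  have "?h ` cbox (c + a) (c + b) = (+) (?h c) ` ?h ` cbox a b"
    unfolding cbox_translation image_image using linear_add[OF lin] by simp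
  then have "measure lebesgue (?h ` cbox a b) = measure lebesgue (?h ` cbox (c + a) (c + b))"
    by (simp only: measure_translation)
  also have "\<dots> = measure lebesgue ((+) c ` cbox a b)"
    unfolding shear by (simp only: cbox_translation)
  finally show ?thesis
    by (simp only: measure_translation)
qed auto

text \<open>The library has this only for a well-ordered index type, which its proof uses in the
  determinant of a shear alone.\<close>

proposition linear_image_lmeasurable:
  fixes f :: "real^'n::finite \<Rightarrow> real^'n"
  assumes "linear f" "S \<in> lmeasurable"
  shows "f ` S \<in> lmeasurable \<and> measure lebesgue (f ` S) = \<bar>det (matrix f)\<bar> * measure lebesgue S"
proof -
  define P where "P f \<longleftrightarrow> (\<forall>S\<in>lmeasurable. f ` S \<in> lmeasurable \<and>
      measure lebesgue (f ` S) = \<bar>det (matrix f)\<bar> * measure lebesgue S)"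
    for f :: "real^'n \<Rightarrow> real^'n"
  \<comment> \<open>Serves coordinate swaps and shears, whose determinants have absolute value 1:
    for these it is enough to measure the images of boxes.\<close>
  have volume_preserving: "P h"
    if h: "linear h" "\<bar>det (matrix h)\<bar> = 1"
      "\<And>a b. measure lebesgue (h ` cbox a b) = measure lebesgue (cbox a b)" for h
    unfolding P_def
  proof
    fix S :: "(real^'n) set"
    assume S: "S \<in> lmeasurable"
    show "h ` S \<in> lmeasurable \<and> measure lebesgue (h ` S) = \<bar>det (matrix h)\<bar> * measure lebesgue S"
      using measure_linear_sufficient[OF h(1) S, of 1] h(2,3) by simp
  qed
  have "P f"
  proof (rule induct_linear_elementary[OF \<open>linear f\<close>])
    fix f g :: "real^'n \<Rightarrow> real^'n"
    assume "linear f" "linear g" "P f" "P g"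
    then show "P (f \<circ> g)"
      unfolding P_def by (metis (no_types, opaque_lifting) abs_mult det_mul image_comp matrix_compose mult.assoc)
  next
    fix f :: "real^'n \<Rightarrow> real^'n" and i
    assume f: "linear f" "\<And>x. f x $ i = 0"
    then have "\<not> surj f"
      by (metis surjD vec_component zero_neq_one)
    then have "\<not> inj f"
      using f(1) linear_injective_imp_surjective by blast
    then show "P f"
      unfolding P_def using f(1) det_nz_iff_inj negligible_linear_singular_image[OF f(1)]
      by (auto simp: negligible_iff_measure)
  next
    fix c :: "'n \<Rightarrow> real"
    have "det (matrix (\<lambda>x::real^'n. \<chi> i. c i * x $ i)) = prod c UNIV"
      by (subst det_diagonal) (auto simp: matrix_def axis_def)
    then show "P (\<lambda>x. \<chi> i. c i * x $ i)"
      by (simp add: P_def measurable_stretch measure_stretch)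
  next
    fix m n :: 'n
    let ?h = "\<lambda>x::real^'n. \<chi> i. x $ Transposition.transpose m n i"
    have lin: "linear ?h"
      by (rule linearI) (auto simp: vec_eq_iff)
    \<comment> \<open>A swap is an involution, so its determinant squares to 1; only the absolute
      value is wanted.\<close>
    have "?h \<circ> ?h = id"
      by (auto simp: vec_eq_iff)
    then have "det (matrix ?h) * det (matrix ?h) = 1"
      using matrix_compose[OF lin lin] by (metis det_I det_mul matrix_id_mat_1)
    then have det: "\<bar>det (matrix ?h)\<bar> = 1"
      by (simp add: square_eq_1_iff) linarith
    have "measure lebesgue (?h ` cbox a b) = measure lebesgue (cbox a b)" for a b
    proof -
      have "?h ` cbox a b = cbox (?h a) (?h b)"
      proof (intro equalityI subsetI)
        fix x assume "x \<in> cbox (?h a) (?h b)"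
        then have "?h x \<in> cbox a b"
          by (auto simp: mem_box_cart) (metis transpose_involutory)+
        moreover have "x = ?h (?h x)"
          by (simp add: vec_eq_iff)
        ultimately show "x \<in> ?h ` cbox a b" by blast
      qed (auto simp: mem_box_cart)
      moreover have "(\<Prod>i\<in>UNIV. ?h b $ i - ?h a $ i) = (\<Prod>i\<in>UNIV. b $ i - a $ i)"
        using prod.permute[OF permutes_swap_id[of m UNIV n], of "\<lambda>i. b $ i - a $ i"]
        by (simp add: comp_def)
      moreover have "cbox (?h a) (?h b) \<noteq> {}" if "cbox a b \<noteq> {}"
        using calculation(1) that by auto
      ultimately show ?thesis
        by (cases "cbox a b = {}") (simp_all add: content_cbox_cart)
    qed
    then show "P (\<lambda>x. \<chi> i. x $ Transposition.transpose m n i)"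
      by (rule volume_preserving[OF lin det])
  next
    fix m n :: 'n
    assume mn: "m \<noteq> n"
    have lin: "linear (\<lambda>x::real^'n. \<chi> i. if i = m then x $ m + x $ n else x $ i)"
      by (rule linearI) (auto simp: vec_eq_iff algebra_simps)
    show "P (\<lambda>x. \<chi> i. if i = m then x $ m + x $ n else x $ i)"
      by (rule volume_preserving[OF lin]) (simp_all only: measure_shear_cbox[OF mn] det_shear[OF mn] abs_one)
  qed
  then show ?thesis using assms unfolding P_def by blast
qed

section \<open>Product measures as Lebesgue measures of cylinders\<close>

lemma emeasure_lborel_vec_box:
  fixes B :: "'n::finite \<Rightarrow> real set"
  assumes "\<And>i. B i \<in> sets borel"
  shows "emeasure lborel {y::real^'n. \<forall>i. y $ i \<in> B i} = (\<Prod>i\<in>UNIV. emeasure lborel (B i))"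
proof -
  have Basis: "(Basis :: (real^'n) set) = (\<lambda>i. axis i 1) ` UNIV" "inj (\<lambda>i::'n. axis i (1::real))"
    by (auto simp: Basis_vec_def inj_on_def axis_eq_axis)
  \<comment> \<open>The integrand becomes a product over basis vectors, as in
    \<open>nn_integral_lborel_prod\<close>; \<open>axis_index\<close> recovers the coordinate from
    its unit vector.\<close>
  let ?f = "\<lambda>b. indicator (B (axis_index b)) :: real \<Rightarrow> ennreal"
  have "emeasure lborel {y::real^'n. \<forall>i. y $ i \<in> B i}
      = (\<integral>\<^sup>+x. indicator {y::real^'n. \<forall>i. y $ i \<in> B i} x \<partial>lborel)"
  proof (rule nn_integral_indicator [symmetric])
    have "{y::real^'n. \<forall>i. y $ i \<in> B i} = (\<Inter>i. (\<lambda>y. y $ i) -` B i \<inter> space borel)"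
      by auto
    moreover have "(\<lambda>y::real^'n. y $ i) -` B i \<inter> space borel \<in> sets borel" for i
      using assms by (intro measurable_sets[of _ borel borel]) auto
    ultimately show "{y::real^'n. \<forall>i. y $ i \<in> B i} \<in> sets lborel"
      by (simp add: sets.finite_INT)
  qed
  also have "\<dots> = (\<integral>\<^sup>+x. (\<Prod>b\<in>Basis. ?f b (x \<bullet> b)) \<partial>(lborel :: (real^'n) measure))"
    unfolding Basis by (subst prod.reindex, simp add: Basis)
      (auto intro!: nn_integral_cong simp: inner_axis axis_index_axis indicator_def)
  also have "\<dots> = (\<Prod>b\<in>Basis. \<integral>\<^sup>+x. ?f (b :: real^'n) x \<partial>lborel)"
    using assms by (intro nn_integral_lborel_prod) auto
  also have "\<dots> = (\<Prod>i\<in>UNIV. emeasure lborel (B i))"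
    unfolding Basis using assms by (subst prod.reindex) (simp_all add: Basis axis_index_axis)
  finally show ?thesis .
qed

lemma measurable_vec_restrict:
  "(\<lambda>y::real^'n. \<lambda>i\<in>I. y $ \<pi> i) \<in> borel \<rightarrow>\<^sub>M (\<Pi>\<^sub>M i\<in>I. lborel)"
  by (rule measurable_restrict) auto

text \<open>The measure of the cylinder, as a function of its base, agrees with the product measure
  on boxes because every coordinate in \<open>K\<close> contributes a factor of length 1. Uniqueness
  of the product measure extends this to all measurable bases.\<close>

lemma emeasure_lborel_cylinder:
  fixes K :: "'n::finite set" and \<pi> :: "'b \<Rightarrow> 'n"
  assumes \<pi>: "bij_betw \<pi> I (- K)" and "A \<in> sets (\<Pi>\<^sub>M i\<in>I. lborel)"
  shows "emeasure lborel {y::real^'n. (\<lambda>i\<in>I. y $ \<pi> i) \<in> A \<and> (\<forall>k\<in>K. y $ k \<in> {0..1})}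
       = emeasure (\<Pi>\<^sub>M i\<in>I. lborel) A"
proof -
  interpret product_sigma_finite "\<lambda>_::'b. lborel :: real measure" by standard
  have fin: "finite I"
    using bij_betw_finite[OF \<pi>] by simp
  define U where "U = {y::real^'n. \<forall>k\<in>K. y $ k \<in> {0..1}}"
  have "U = (\<Inter>k\<in>K. (\<lambda>y. y $ k) -` {0..1})"
    by (auto simp: U_def)
  then have "closed U"
    by (auto intro!: closed_vimage continuous_intros)
  then have [measurable]: "U \<in> sets borel" by auto
  define \<mu> where "\<mu> = distr (restrict_space lborel U) (\<Pi>\<^sub>M i\<in>I. lborel) (\<lambda>y::real^'n. \<lambda>i\<in>I. y $ \<pi> i)"
  have meas: "(\<lambda>y::real^'n. \<lambda>i\<in>I. y $ \<pi> i) \<in> restrict_space lborel U \<rightarrow>\<^sub>M (\<Pi>\<^sub>M i\<in>I. lborel)"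
    by (rule measurable_restrict_space1) (simp add: measurable_vec_restrict)
  have em: "emeasure \<mu> X = emeasure lborel {y::real^'n. (\<lambda>i\<in>I. y $ \<pi> i) \<in> X \<and> y \<in> U}"
    if "X \<in> sets (\<Pi>\<^sub>M i\<in>I. lborel)" for X
    unfolding \<mu>_def
    by (subst emeasure_distr[OF meas that], subst emeasure_restrict_space)
       (auto simp: space_restrict_space intro!: arg_cong[of _ _ "emeasure lborel"])
  have "\<mu> = (\<Pi>\<^sub>M i\<in>I. lborel)"
  proof (rule PiM_eqI[OF fin])
    fix X assume X: "\<And>i. i \<in> I \<Longrightarrow> X i \<in> sets (lborel :: real measure)"
    define B where "B j = (if j \<in> K then {0..1} else X (inv_into I \<pi> j))" for j
    have inv: "inv_into I \<pi> (\<pi> i) = i" "\<pi> i \<notin> K" if "i \<in> I" for i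
      using \<pi> that by (auto simp: bij_betw_def)
    have B: "B j \<in> sets borel" for j
    proof (cases "j \<in> K")
      case False
      then have "inv_into I \<pi> j \<in> I"
        using \<pi> by (metis ComplI bij_betw_imp_surj_on inv_into_into)
      then show ?thesis using X False by (simp add: B_def)
    qed (simp add: B_def)
    have "{y::real^'n. (\<lambda>i\<in>I. y $ \<pi> i) \<in> Pi\<^sub>E I X \<and> y \<in> U} = {y. \<forall>j. y $ j \<in> B j}"
    proof -
      have "((\<lambda>i\<in>I. y $ \<pi> i) \<in> Pi\<^sub>E I X) = (\<forall>j\<in>-K. y $ j \<in> B j)" for y :: "real^'n"
      proof -
        have "- K = \<pi> ` I"
          using \<pi> by (simp add: bij_betw_def)
        moreover have "B (\<pi> i) = X i" if "i \<in> I" for i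
          using inv[OF that] by (simp add: B_def)
        ultimately show ?thesis
          by (simp add: PiE_iff)
      qed
      then show ?thesis
        by (auto simp: U_def B_def split: if_splits)
    qed
    then have "emeasure \<mu> (Pi\<^sub>E I X) = (\<Prod>j\<in>UNIV. emeasure lborel (B j))"
      using em[of "Pi\<^sub>E I X"] X fin emeasure_lborel_vec_box[OF B] by (simp add: sets_PiM_I_finite)
    also have "\<dots> = (\<Prod>j\<in>-K. emeasure lborel (B j))"
      by (rule prod.mono_neutral_right) (auto simp: B_def)
    also have "\<dots> = (\<Prod>i\<in>I. emeasure lborel (X i))"
      by (rule prod.reindex_bij_betw[OF \<pi>, symmetric, THEN trans]) (simp add: B_def inv)
    finally show "emeasure \<mu> (Pi\<^sub>E I X) = (\<Prod>i\<in>I. emeasure lborel (X i))" .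
  qed (simp add: \<mu>_def)
  then show ?thesis
    using em[OF assms(2)] by (simp add: U_def)
qed

subsection \<open>Volumes in lattice charts\<close>

lemma cylinder_borel:
  fixes K :: "'n::finite set"
  assumes "A \<in> sets (\<Pi>\<^sub>M i\<in>I. lborel)"
  shows "{y::real^'n. (\<lambda>i\<in>I. y $ \<pi> i) \<in> A \<and> (\<forall>k\<in>K. y $ k \<in> {0..1})} \<in> sets borel"
proof -
  have "{y::real^'n. (\<lambda>i\<in>I. y $ \<pi> i) \<in> A \<and> (\<forall>k\<in>K. y $ k \<in> {0..1})}
      = ((\<lambda>y. \<lambda>i\<in>I. y $ \<pi> i) -` A \<inter> space borel) \<inter> (\<Inter>k\<in>K. (\<lambda>y. y $ k) -` {0..1})"
    by auto
  moreover have "closed (\<Inter>k\<in>K. (\<lambda>y::real^'n. y $ k) -` {0..1})"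
    by (auto intro!: closed_vimage continuous_intros)
  ultimately show ?thesis
    using measurable_sets[OF measurable_vec_restrict[of \<pi> I] assms]
    by (metis (no_types, lifting) borel_closed sets.Int)
qed

text \<open>Thickening by the unit cube in the coordinates \<open>K\<close> turns a volume in dimension \<open>card (- K)\<close>
  into a Lebesgue measure on the full space, where the determinant formula applies.\<close>

definition prism :: "'n::finite set \<Rightarrow> (real^'n) set \<Rightarrow> (real^'n) set" where
  "prism K Q = {q + t |q t. q \<in> Q \<and> t \<in> cbox 0 (\<chi> i. if i \<in> K then 1 else 0)}"

lemma compact_prism: "compact Q \<Longrightarrow> compact (prism K Q)"
  unfolding prism_def by (intro compact_sums compact_cbox)

lemma matrix_vector_mult_split_columns:
  fixes M :: "real^'n^'n::finite"
  assumes \<pi>: "bij_betw \<pi> I (- K)" and M: "\<And>k. k \<in> K \<Longrightarrow> column k M = axis k 1"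
  shows "M *v y = (\<Sum>i\<in>I. y $ \<pi> i *\<^sub>R column (\<pi> i) M) + (\<chi> j. if j \<in> K then y $ j else 0)"
proof -
  have "M *v y = (\<Sum>j\<in>UNIV. y $ j *\<^sub>R column j M)"
    by (simp add: matrix_mult_sum scalar_mult_eq_scaleR)
  also have "\<dots> = (\<Sum>j\<in>-K. y $ j *\<^sub>R column j M) + (\<Sum>j\<in>K. y $ j *\<^sub>R column j M)"
    by (subst sum.union_disjoint [symmetric]) auto
  also have "(\<Sum>j\<in>K. y $ j *\<^sub>R column j M) = (\<chi> j. if j \<in> K then y $ j else 0)"
  proof -
    have "(\<Sum>j\<in>K. y $ j *\<^sub>R column j M) = (\<Sum>j\<in>K. y $ j *\<^sub>R axis j 1)"
      using M by (intro sum.cong) auto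
    then show ?thesis
      by (simp add: vec_eq_iff axis_def if_distrib cong: if_cong)
  qed
  finally show ?thesis
    using sum.reindex_bij_betw[OF \<pi>, of "\<lambda>j. y $ j *\<^sub>R column j M"] by simp
qed

text \<open>The unit cylinder over \<open>A\<close> has the measure of \<open>A\<close>, and the
  affine map with linear part \<open>M\<close> and translation \<open>p\<close> takes it onto the
  prism over \<open>Q\<close>, since \<open>M\<close> fixes the unit vectors of
  \<open>K\<close>.\<close>

lemma measure_prism:
  fixes M :: "real^'n^'n::finite"
  assumes \<pi>: "bij_betw \<pi> I (- K)" and M: "\<And>k. k \<in> K \<Longrightarrow> column k M = axis k 1"
    and "det M \<noteq> 0" and A: "A \<in> sets (\<Pi>\<^sub>M i\<in>I. lborel)" and "compact Q"
    and Q: "Q = (\<lambda>x. p + (\<Sum>i\<in>I. x i *\<^sub>R column (\<pi> i) M)) ` A"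
  shows "A \<in> fmeasurable (\<Pi>\<^sub>M i\<in>I. lborel)"
    and "measure lebesgue (prism K Q) = \<bar>det M\<bar> * measure (\<Pi>\<^sub>M i\<in>I. lborel) A"
proof -
  define C where "C = {y::real^'n. (\<lambda>i\<in>I. y $ \<pi> i) \<in> A \<and> (\<forall>k\<in>K. y $ k \<in> {0..1})}"
  have prism_eq: "prism K Q = (+) p ` (*v) M ` C"
  proof (intro equalityI subsetI)
    fix z assume "z \<in> prism K Q"
    then obtain x t where x: "x \<in> A" and z: "z = p + (\<Sum>i\<in>I. x i *\<^sub>R column (\<pi> i) M) + t"
      and t: "t \<in> cbox 0 (\<chi> i. if i \<in> K then 1 else 0)"
      unfolding prism_def Q by blast
    define y :: "real^'n" where "y = (\<chi> j. if j \<in> K then t $ j else x (inv_into I \<pi> j))"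
    have yi: "y $ \<pi> i = x i" if "i \<in> I" for i
      using \<pi> that by (auto simp: y_def bij_betw_def)
    have "x \<in> extensional I"
      using x sets.sets_into_space[OF A] by (auto simp: space_PiM PiE_def)
    then have "(\<lambda>i\<in>I. y $ \<pi> i) = x"
      using yi by (auto simp: extensional_def)
    moreover have "y $ k \<in> {0..1}" if "k \<in> K" for k
      using t that by (auto simp: y_def mem_box_cart dest: spec[of _ k])
    ultimately have "y \<in> C"
      using x by (simp add: C_def)
    moreover have "(\<chi> j. if j \<in> K then y $ j else 0) = t"
    proof -
      have "t $ j = 0" if "j \<notin> K" for j
        using t that by (auto simp: mem_box_cart intro: antisym dest: spec[of _ j])
      then show ?thesis
        by (auto simp: y_def vec_eq_iff)
    qed
    then have "z = p + M *v y"
      by (simp add: z matrix_vector_mult_split_columns[OF \<pi> M] yi)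
    ultimately show "z \<in> (+) p ` (*v) M ` C"
      by blast
  next
    fix z assume "z \<in> (+) p ` (*v) M ` C"
    then obtain y where y: "y \<in> C" "z = p + M *v y"
      by auto
    have "p + (\<Sum>i\<in>I. (\<lambda>i\<in>I. y $ \<pi> i) i *\<^sub>R column (\<pi> i) M) \<in> Q"
      using y(1) unfolding Q C_def by blast
    moreover have "(\<chi> j. if j \<in> K then y $ j else 0) \<in> cbox 0 (\<chi> i. if i \<in> K then 1 else 0)"
      using y(1) by (auto simp: C_def mem_box_cart)
    ultimately show "z \<in> prism K Q"
      using matrix_vector_mult_split_columns[OF \<pi> M, of y]
      unfolding prism_def y(2) by (intro CollectI exI conjI) (auto simp: add.assoc)
  qed
  \<comment> \<open>Finiteness of the measure is pulled back from the compact prism through the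
    inverse matrix, as \<open>A\<close> is only assumed measurable.\<close>
  obtain N where inv: "N ** M = mat 1"
    using assms(3) unfolding invertible_det_nz [symmetric] invertible_def by blast
  have "C = (*v) N ` (*v) M ` C"
    by (simp add: image_image matrix_vector_mul_assoc inv)
  also have "(*v) M ` C = (+) (- p) ` prism K Q"
    unfolding prism_eq image_image by simp
  finally have C: "C = (*v) N ` (+) (- p) ` prism K Q" .
  have "prism K Q \<in> lmeasurable"
    using compact_prism[OF \<open>compact Q\<close>] by (rule lmeasurable_compact)
  then have "C \<in> lmeasurable"
    unfolding C
    using linear_image_lmeasurable[OF matrix_vector_mul_linear, of "(+) (- p) ` prism K Q" N]
      measurable_translation[of "prism K Q" "- p"] by blast
  have "C \<in> sets borel"
    unfolding C_def using A by (rule cylinder_borel)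
  have em: "emeasure (\<Pi>\<^sub>M i\<in>I. lborel) A = emeasure lebesgue C"
    using emeasure_lborel_cylinder[OF \<pi> A] \<open>C \<in> sets borel\<close> by (simp add: C_def)
  show "A \<in> fmeasurable (\<Pi>\<^sub>M i\<in>I. lborel)"
    using \<open>C \<in> lmeasurable\<close> A em unfolding fmeasurable_def by (metis (no_types, lifting) mem_Collect_eq)
  have "measure lebesgue (prism K Q) = \<bar>det M\<bar> * measure lebesgue C"
    unfolding prism_eq measure_translation
    using linear_image_lmeasurable[OF matrix_vector_mul_linear[of M] \<open>C \<in> lmeasurable\<close>] by simp
  then show "measure lebesgue (prism K Q) = \<bar>det M\<bar> * measure (\<Pi>\<^sub>M i\<in>I. lborel) A"
    by (simp add: measure_def em)
qed

text \<open>On a graph over the coordinates outside \<open>K\<close>, the lattice points together with the unit vectors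
  of \<open>K\<close> span the full lattice: any lattice basis is completed by them to a unimodular matrix.\<close>

definition integral_graph :: "'n::finite set \<Rightarrow> (real^'n) set \<Rightarrow> bool" where
  "integral_graph K H \<longleftrightarrow> (\<exists>p \<alpha>. (\<forall>k. p k \<in> \<int>) \<and> (\<forall>k i. \<alpha> k i \<in> \<int>) \<and>
     H = {x. \<forall>k\<in>K. x $ k = p k + (\<Sum>i\<in>-K. \<alpha> k i * x $ i)})"

text \<open>Integer coefficients make the dependent coordinates integral over an integral base
  point, so the lattice of \<open>H\<close> projects onto the whole integer lattice outside
  \<open>K\<close>.\<close>

lemma integral_graph_lift:
  assumes "integral_graph K H" "z \<in> integer_points"
  obtains y where "y \<in> H \<inter> integer_points" "\<And>i. i \<notin> K \<Longrightarrow> y $ i = z $ i"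
proof -
  obtain p \<alpha> where p: "\<And>k. p k \<in> \<int>" "\<And>k i. \<alpha> k i \<in> \<int>"
    and H: "H = {x. \<forall>k\<in>K. x $ k = p k + (\<Sum>i\<in>-K. \<alpha> k i * x $ i)}"
    using assms(1) by (auto simp: integral_graph_def)
  define y where "y = (\<chi> k. if k \<in> K then p k + (\<Sum>i\<in>-K. \<alpha> k i * z $ i) else z $ k)"
  have "y \<in> H"
    by (auto simp: H y_def)
  moreover have "y \<in> integer_points"
    using assms(2) p by (auto simp: y_def integer_points_def intro!: Ints_add Ints_sum Ints_mult)
  ultimately show thesis
    using that by (simp add: y_def)
qed

lemma det_in_Ints:
  fixes M :: "real^'n^'n::finite"
  assumes "\<And>i j. M $ i $ j \<in> \<int>"
  shows "det M \<in> \<int>"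
  unfolding det_def using assms by (intro Ints_sum Ints_mult Ints_prod Ints_of_int) auto

text \<open>The two determinants are integers with product 1, hence units of the integers.\<close>

lemma abs_det_eq_1_if_integral_inverse:
  fixes M N :: "real^'n^'n::finite"
  assumes "\<And>i j. M $ i $ j \<in> \<int>" "\<And>i j. N $ i $ j \<in> \<int>" "M ** N = mat 1"
  shows "\<bar>det M\<bar> = 1"
proof -
  obtain a b where ab: "det M = of_int a" "det N = of_int b"
    using det_in_Ints[OF assms(1)] det_in_Ints[OF assms(2)] by (meson Ints_cases)
  have "det M * det N = 1"
    using assms(3) by (metis det_I det_mul)
  then have "a * b = 1"
    unfolding ab by (metis of_int_eq_1_iff of_int_mult)
  then show ?thesis
    using ab by (auto simp: zmult_eq_1_iff)
qed

lemma affine_chart_diff: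
  "affine_chart D p b x - affine_chart D p b y = (\<Sum>i<D. (x i - y i) *\<^sub>R b i)"
  by (simp add: affine_chart_def sum_subtractf scaleR_left_diff_distrib)

text \<open>Completing the directions of a lattice chart by the unit vectors of \<open>K\<close>
  gives a unimodular matrix, so the determinant factor of \<open>measure_prism\<close> is 1. The
  prism does not mention the chart: volumes agree in all lattice charts and may be computed with any
  suitable \<open>K\<close>.\<close>

proposition measure_affine_chart_vimage:
  fixes Q :: "(real^'n::finite) set"
  assumes iso: "affine_lattice_iso (card (- K)) p b (H \<inter> integer_points)"
    and H: "integral_graph K H" and "compact Q" and Q: "Q \<subseteq> convex hull (H \<inter> integer_points)"
  defines "A \<equiv> {x \<in> {..<card (- K)} \<rightarrow>\<^sub>E UNIV. affine_chart (card (- K)) p b x \<in> Q}"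
  shows "A \<in> fmeasurable (\<Pi>\<^sub>M i\<in>{..<card (- K)}. lborel)"
    and "measure (\<Pi>\<^sub>M i\<in>{..<card (- K)}. lborel) A = measure lebesgue (prism K Q)"
proof -
  define D where "D = card (- K)"
  define L where "L = H \<inter> integer_points"
  let ?chart = "affine_chart D p b"
  have bij: "bij_betw ?chart ({..<D} \<rightarrow>\<^sub>E \<int>) L"
    using iso by (simp add: affine_lattice_iso_def D_def L_def)
  have chart_L: "?chart x \<in> L" if "x \<in> {..<D} \<rightarrow>\<^sub>E \<int>" for x
    using bij that by (auto simp: bij_betw_def)
  obtain \<pi> where \<pi>: "bij_betw \<pi> {..<D} (- K)"
    using ex_bij_betw_nat_finite[of "- K"] by (auto simp: D_def lessThan_atLeast0)
  define M :: "real^'n^'n" where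
    "M = (\<chi> r c. if c \<in> K then axis c 1 $ r else b (inv_into {..<D} \<pi> c) $ r)"
  have colK: "column k M = axis k 1" if "k \<in> K" for k
    using that by (simp add: M_def column_def vec_eq_iff)
  have col\<pi>: "column (\<pi> i) M = b i" if "i < D" for i
    using \<pi> that by (auto simp: M_def column_def vec_eq_iff bij_betw_def)
  define z0 where "z0 = (\<lambda>i\<in>{..<D}. 0 :: real)"
  have z0: "z0 \<in> {..<D} \<rightarrow>\<^sub>E \<int>" "?chart z0 = p"
    by (auto simp: z0_def affine_chart_def)
  \<comment> \<open>Each direction is the difference of two lattice points, the images of a unit
    point and of the origin.\<close>
  have b_int: "b i $ r \<in> \<int>" if "i < D" for i r
  proof -
    define e where "e = (\<lambda>j\<in>{..<D}. if j = i then 1 else 0 :: real)"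
    have "?chart e - ?chart z0 = b i"
      unfolding affine_chart_diff using that
      by (simp add: e_def z0_def if_distrib[of "\<lambda>c. c *\<^sub>R _"] cong: if_cong)
    moreover have "e \<in> {..<D} \<rightarrow>\<^sub>E \<int>"
      by (auto simp: e_def)
    ultimately have "b i $ r = ?chart e $ r - ?chart z0 $ r" "?chart e \<in> L" "?chart z0 \<in> L"
      using chart_L z0(1) by (auto simp flip: vector_minus_component)
    then show ?thesis
      by (simp add: L_def integer_points_def)
  qed
  have M_int: "M $ r $ c \<in> \<int>" for r c
  proof (cases "c \<in> K")
    case False
    then have "inv_into {..<D} \<pi> c < D"
      using \<pi> by (metis ComplI bij_betw_imp_surj_on inv_into_into lessThan_iff)
    then show ?thesis
      using False b_int by (simp add: M_def)
  qed (simp add: M_def axis_def)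
  \<comment> \<open>Integral solvability: a lattice point \<open>y\<close> of \<open>H\<close>
    matches \<open>z + p\<close> outside \<open>K\<close>; its chart coordinates, with the defect
    \<open>z + p - y\<close> on \<open>K\<close>, solve the system.\<close>
  have "\<exists>w. w \<in> integer_points \<and> M *v w = z" if z: "z \<in> integer_points" for z
  proof -
    have p_int: "p \<in> integer_points"
      using chart_L[OF z0(1)] by (simp add: z0(2) L_def)
    then have "z + p \<in> integer_points"
      using z by (simp add: integer_points_def)
    then obtain y where y: "y \<in> L" "\<And>i. i \<notin> K \<Longrightarrow> y $ i = (z + p) $ i"
      using integral_graph_lift[OF H] unfolding L_def by metis
    then obtain x where x: "x \<in> {..<D} \<rightarrow>\<^sub>E \<int>" "?chart x = y"
      using bij by (metis bij_betw_imp_surj_on imageE)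
    define w :: "real^'n" where
      "w = (\<chi> j. if j \<in> K then (z + p - y) $ j else x (inv_into {..<D} \<pi> j))"
    have w: "w $ \<pi> i = x i" if "i < D" for i
      using \<pi> that by (auto simp: w_def bij_betw_def)
    have "w $ j \<in> \<int>" for j
    proof (cases "j \<in> K")
      case True
      then show ?thesis
        using z p_int y(1) by (simp add: w_def integer_points_def L_def)
    next
      case False
      then have "j \<in> \<pi> ` {..<D}"
        using \<pi> by (simp add: bij_betw_def)
      then show ?thesis
        using w x(1) by auto
    qed
    moreover have "M *v w = z"
    proof -
      have "(\<Sum>i<D. w $ \<pi> i *\<^sub>R column (\<pi> i) M) = y - p"
        using x(2) w col\<pi> by (auto simp: affine_chart_def)
      moreover have "(\<chi> j. if j \<in> K then w $ j else 0) = z + p - y"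
        using y(2) by (simp add: w_def vec_eq_iff)
      ultimately show ?thesis
        by (simp add: matrix_vector_mult_split_columns[OF \<pi> colK])
    qed
    ultimately show ?thesis
      by (auto simp: integer_points_def)
  qed
  moreover have "axis c 1 \<in> integer_points" for c :: 'n
    by (simp add: integer_points_def axis_def)
  ultimately have "\<forall>c. \<exists>w. w \<in> integer_points \<and> M *v w = axis c 1"
    by blast
  then obtain w where w: "\<And>c. w c \<in> integer_points" "\<And>c. M *v w c = axis c 1"
    unfolding choice_iff by blast
  have det: "\<bar>det M\<bar> = 1"
  proof (rule abs_det_eq_1_if_integral_inverse)
    show "(\<chi> r c. w c $ r) $ i $ j \<in> \<int>" for i j
      using w(1)[of j] by (simp add: integer_points_def)
    show "M ** (\<chi> r c. w c $ r) = mat 1"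
      using w(2) by (simp add: vec_eq_iff matrix_matrix_mult_def matrix_vector_mult_def mat_def axis_def)
  qed (rule M_int)
  \<comment> \<open>The chart is known to be bijective only on integer points. Its real image is
    convex and contains \<open>L\<close>, so it contains \<open>Q\<close>.\<close>
  have "Q \<subseteq> ?chart ` ({..<D} \<rightarrow>\<^sub>E UNIV)"
  proof -
    have "L \<subseteq> ?chart ` ({..<D} \<rightarrow>\<^sub>E UNIV)"
      using bij by (auto simp: bij_betw_def intro!: imageI)
    moreover have "convex (?chart ` ({..<D} \<rightarrow>\<^sub>E UNIV))"
    proof (rule convexI, elim imageE)
      fix u v :: real and x y y1 y2
      assume uv: "u + v = 1" and y: "y1 = ?chart x" "y2 = ?chart y"
      have "u *\<^sub>R y1 + v *\<^sub>R y2 = ?chart (\<lambda>i\<in>{..<D}. u * x i + v * y i)"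
      proof -
        have "u *\<^sub>R p + v *\<^sub>R p = p"
          using uv by (metis scaleR_left_distrib scaleR_one)
        then show ?thesis
          by (simp add: y affine_chart_def scaleR_right_distrib scaleR_left_distrib sum.distrib
              scaleR_sum_right algebra_simps)
      qed
      then show "u *\<^sub>R y1 + v *\<^sub>R y2 \<in> ?chart ` ({..<D} \<rightarrow>\<^sub>E UNIV)"
        by simp
    qed
    ultimately show ?thesis
      using Q hull_minimal[of L _ convex] unfolding L_def by blast
  qed
  then have Q_eq: "Q = ?chart ` A"
    unfolding A_def D_def by blast
  have "?chart \<in> (\<Pi>\<^sub>M i\<in>{..<D}. lborel) \<rightarrow>\<^sub>M borel"
    unfolding affine_chart_def by measurable
  moreover have "A = ?chart -` Q \<inter> space (\<Pi>\<^sub>M i\<in>{..<D}. lborel)"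
    by (auto simp: A_def D_def space_PiM)
  ultimately have A: "A \<in> sets (\<Pi>\<^sub>M i\<in>{..<D}. lborel)"
    using \<open>compact Q\<close> by (simp add: borel_closed compact_imp_closed measurable_sets)
  have "Q = (\<lambda>x. p + (\<Sum>i<D. x i *\<^sub>R column (\<pi> i) M)) ` A"
    unfolding Q_eq affine_chart_def using col\<pi> by simp
  note prism = measure_prism[OF \<pi> colK _ A \<open>compact Q\<close> this]
  show "A \<in> fmeasurable (\<Pi>\<^sub>M i\<in>{..<card (- K)}. lborel)"
    "measure (\<Pi>\<^sub>M i\<in>{..<card (- K)}. lborel) A = measure lebesgue (prism K Q)"
    using prism det unfolding D_def by auto
qed

section \<open>Charts and dimension of integral graphs\<close>

lemma integral_graph_affine_lattice_iso:
  fixes K :: "'n::finite set"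
  assumes "integral_graph K H"
  obtains p b where "affine_lattice_iso (card (- K)) p b (H \<inter> integer_points)"
proof -
  obtain p \<alpha> where p: "\<And>k. p k \<in> \<int>" "\<And>k i. \<alpha> k i \<in> \<int>"
    and H: "H = {x. \<forall>k\<in>K. x $ k = p k + (\<Sum>i\<in>-K. \<alpha> k i * x $ i)}"
    using assms by (auto simp: integral_graph_def)
  define D where "D = card (- K)"
  obtain \<pi> where \<pi>: "bij_betw \<pi> {..<D} (- K)"
    using ex_bij_betw_nat_finite[of "- K"] by (auto simp: D_def lessThan_atLeast0)
  define p' :: "real^'n" where "p' = (\<chi> j. if j \<in> K then p j else 0)"
  \<comment> \<open>The direction \<open>b i\<close> moves coordinate \<open>\<pi> i\<close> by 1
    and follows the graph on \<open>K\<close>; restricting to the coordinates outside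
    \<open>K\<close> inverts the chart.\<close>
  define b :: "nat \<Rightarrow> real^'n"
    where "b i = (\<chi> j. if j \<in> K then \<alpha> j (\<pi> i) else if j = \<pi> i then 1 else 0)" for i
  let ?chart = "affine_chart D p' b"
  have notin_K: "\<pi> i \<notin> K" if "i < D" for i
    using \<pi> that by (auto simp: bij_betw_def)
  have chart_\<pi>: "?chart x $ \<pi> i = x i" if "i < D" for x i
  proof -
    have "x l * b l $ \<pi> i = (if l = i then x l else 0)" if "l < D" for l
      using \<pi> notin_K that \<open>i < D\<close> by (auto simp: b_def bij_betw_def inj_on_def)
    then show ?thesis
      using that notin_K by (simp add: affine_chart_def p'_def)
  qed
  have sum_\<pi>: "(\<Sum>i\<in>-K. f i) = (\<Sum>i<D. f (\<pi> i))" for f :: "'n \<Rightarrow> real"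
    using sum.reindex_bij_betw[OF \<pi>, of f] by simp
  have chart_K: "?chart x $ k = p k + (\<Sum>i<D. x i * \<alpha> k (\<pi> i))" if "k \<in> K" for x k
    using that by (simp add: affine_chart_def p'_def b_def)
  have "bij_betw ?chart ({..<D} \<rightarrow>\<^sub>E \<int>) (H \<inter> integer_points)"
  proof (rule bij_betw_byWitness[where f' = "\<lambda>y. \<lambda>i\<in>{..<D}. y $ \<pi> i"])
    show "\<forall>x\<in>{..<D} \<rightarrow>\<^sub>E \<int>. (\<lambda>i\<in>{..<D}. ?chart x $ \<pi> i) = x"
    proof (intro ballI ext)
      fix x i assume x: "x \<in> {..<D} \<rightarrow>\<^sub>E (\<int> :: real set)"
      show "(\<lambda>i\<in>{..<D}. ?chart x $ \<pi> i) i = x i"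
        using PiE_arb[OF x, of i] by (cases "i < D") (simp_all add: chart_\<pi>)
    qed
    show "\<forall>y\<in>H \<inter> integer_points. ?chart (\<lambda>i\<in>{..<D}. y $ \<pi> i) = y"
    proof
      fix y assume y: "y \<in> H \<inter> integer_points"
      have "?chart (\<lambda>i\<in>{..<D}. y $ \<pi> i) $ j = y $ j" for j
      proof (cases "j \<in> K")
        case True
        then show ?thesis
          using y by (simp add: chart_K H sum_\<pi> mult.commute)
      next
        case False
        then obtain i where "i < D" "j = \<pi> i"
          using \<pi> by (metis ComplI bij_betw_imp_surj_on imageE lessThan_iff)
        then show ?thesis
          by (simp add: chart_\<pi>)
      qed
      then show "?chart (\<lambda>i\<in>{..<D}. y $ \<pi> i) = y"
        by (simp add: vec_eq_iff)
    qed
    show "?chart ` ({..<D} \<rightarrow>\<^sub>E \<int>) \<subseteq> H \<inter> integer_points"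
    proof (intro image_subsetI IntI)
      fix x :: "nat \<Rightarrow> real" assume x: "x \<in> {..<D} \<rightarrow>\<^sub>E \<int>"
      show "?chart x \<in> H"
        by (simp add: H chart_K sum_\<pi> chart_\<pi> mult.commute)
      have "?chart x $ j \<in> \<int>" for j
      proof (cases "j \<in> K")
        case True
        then show ?thesis
          using p x by (auto simp: chart_K intro!: Ints_add Ints_sum Ints_mult)
      next
        case False
        then obtain i where "i < D" "j = \<pi> i"
          using \<pi> by (metis ComplI bij_betw_imp_surj_on imageE lessThan_iff)
        then show ?thesis
          using x by (auto simp: chart_\<pi>)
      qed
      then show "?chart x \<in> integer_points"
        by (simp add: integer_points_def)
    qed
    show "(\<lambda>y. \<lambda>i\<in>{..<D}. y $ \<pi> i) ` (H \<inter> integer_points) \<subseteq> {..<D} \<rightarrow>\<^sub>E \<int>"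
      by (simp add: image_subset_iff integer_points_def restrict_PiE_iff)
  qed
  then show thesis
    using that unfolding affine_lattice_iso_def D_def by blast
qed

text \<open>The graph is a translate of the image of a coordinate subspace under the injective shear
  \<open>G\<close>.\<close>

lemma aff_dim_integral_graph:
  fixes K :: "'n::finite set"
  assumes "integral_graph K H"
  shows "aff_dim H = int (card (- K))"
proof -
  obtain p \<alpha> where H: "H = {x. \<forall>k\<in>K. x $ k = p k + (\<Sum>i\<in>-K. \<alpha> k i * x $ i)}"
    using assms by (auto simp: integral_graph_def)
  define V where "V = {x::real^'n. \<forall>i. i \<notin> - K \<longrightarrow> x $ i = 0}"
  define G :: "real^'n \<Rightarrow> real^'n"
    where "G x = x + (\<chi> k. if k \<in> K then \<Sum>i\<in>-K. \<alpha> k i * x $ i else 0)" for x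
  define p' :: "real^'n" where "p' = (\<chi> k. if k \<in> K then p k else 0)"
  have "linear G"
    by (rule linearI)
      (auto simp: G_def vec_eq_iff algebra_simps sum.distrib sum_distrib_left)
  moreover have "inj G"
  proof -
    have "x = 0" if "G x = 0" for x
    proof -
      have off: "x $ i = 0" if "i \<notin> K" for i
        using \<open>G x = 0\<close> that by (auto simp: G_def vec_eq_iff dest: spec[of _ i])
      then have "x $ k = 0" if "k \<in> K" for k
        using \<open>G x = 0\<close> that by (auto simp: G_def vec_eq_iff dest: spec[of _ k])
      with off show ?thesis
        by (metis vec_eq_iff zero_index)
    qed
    then show ?thesis
      using \<open>linear G\<close> linear_injective_0 by blast
  qed
  moreover have "H = (+) p' ` G ` V"
  proof (intro equalityI subsetI)
    fix y assume y: "y \<in> H"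
    define x :: "real^'n" where "x = (\<chi> i. if i \<in> K then 0 else y $ i)"
    have "y = p' + G x"
      using y by (auto simp: H p'_def G_def x_def vec_eq_iff)
    moreover have "x \<in> V"
      by (simp add: V_def x_def)
    ultimately show "y \<in> (+) p' ` G ` V"
      by blast
  qed (auto simp: H V_def G_def p'_def)
  ultimately have "aff_dim H = aff_dim V"
    by (metis aff_dim_injective_linear_image aff_dim_translation_eq)
  also have "\<dots> = int (dim V)"
    by (intro aff_dim_subspace subspace_def[THEN iffD2]) (auto simp: V_def)
  also have "dim V = card (- K)"
    unfolding V_def by (simp only: dim_vec_eq [symmetric] dim_substandard_cart)
  finally show ?thesis .
qed

text \<open>A family may repeat points, while the characterization \<open>affine\<close> sums over
  sets, so the weights of equal points are first collected in \<open>w\<close>.\<close>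

lemma affine_sum_image:
  fixes a :: "'i \<Rightarrow> 'b::real_vector"
  assumes "affine S" "finite I" "sum u I = 1" "\<And>i. i \<in> I \<Longrightarrow> a i \<in> S"
  shows "(\<Sum>i\<in>I. u i *\<^sub>R a i) \<in> S"
proof -
  define w where "w y = (\<Sum>i | i \<in> I \<and> a i = y. u i)" for y
  have "sum w (a ` I) = 1"
    using assms(3) sum.image_gen[OF assms(2), of u a] by (simp add: w_def)
  moreover have "(\<Sum>i\<in>I. u i *\<^sub>R a i) = (\<Sum>y\<in>a ` I. w y *\<^sub>R y)"
    unfolding w_def scaleR_left.sum sum.image_gen[OF assms(2), of "\<lambda>i. u i *\<^sub>R a i" a]
    by (intro sum.cong) auto
  moreover have "I \<noteq> {}"
    using assms(3) by auto
  ultimately show ?thesis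
    using assms unfolding affine by (auto simp: image_subset_iff)
qed

text \<open>Replaces the chart chosen by \<open>SOME\<close> in the definition by an unspecified
  lattice chart; the existence of one makes the choice meaningful.\<close>

lemma normalized_volume_integral_graph:
  fixes P :: "(real^'n::finite) set"
  assumes "integral_graph K (affine hull P)"
  obtains p b where "affine_lattice_iso (card (- K)) p b (affine hull P \<inter> integer_points)"
    and "normalized_volume P = fact (card (- K)) * measure (\<Pi>\<^sub>M i\<in>{..<card (- K)}. lborel)
           {x \<in> {..<card (- K)} \<rightarrow>\<^sub>E UNIV. affine_chart (card (- K)) p b x \<in> P}"
proof -
  have D: "nat (aff_dim P) = card (- K)"
    using aff_dim_integral_graph[OF assms] by simp
  define pb where "pb = (SOME (p, b). affine_lattice_iso (card (- K)) p b (affine hull P \<inter> integer_points))"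
  obtain p b where pb: "pb = (p, b)"
    by (cases pb)
  have "\<exists>pb. case pb of (p, b) \<Rightarrow> affine_lattice_iso (card (- K)) p b (affine hull P \<inter> integer_points)"
    using integral_graph_affine_lattice_iso[OF assms] by (metis case_prodI)
  then have "case pb of (p, b) \<Rightarrow> affine_lattice_iso (card (- K)) p b (affine hull P \<inter> integer_points)"
    unfolding pb_def by (rule someI_ex)
  then show thesis
    using that[of p b] pb unfolding normalized_volume_def D Let_def pb_def[symmetric] by simp
qed

subsection \<open>Simplices\<close>

lemma convex_hull_finite_image:
  fixes w :: "'a \<Rightarrow> 'b::real_vector"
  assumes "finite S"
  shows "convex hull (w ` S) = {\<Sum>j\<in>S. u j *\<^sub>R w j |u. (\<forall>j\<in>S. 0 \<le> u j) \<and> sum u S = 1}"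
    (is "_ = ?R")
proof
  show "?R \<subseteq> convex hull (w ` S)"
  proof clarify
    fix u :: "'a \<Rightarrow> real" assume "\<forall>j\<in>S. 0 \<le> u j" "sum u S = 1"
    then show "(\<Sum>j\<in>S. u j *\<^sub>R w j) \<in> convex hull (w ` S)"
      using assms by (intro convex_sum) (auto intro: hull_inc)
  qed
  show "convex hull (w ` S) \<subseteq> ?R"
  proof (rule hull_minimal)
    show "w ` S \<subseteq> ?R"
    proof clarify
      fix k assume k: "k \<in> S"
      have "w k = (\<Sum>j\<in>S. (if j = k then 1 else 0) *\<^sub>R w j)"
        using assms k by (simp add: if_distrib[of "\<lambda>c. c *\<^sub>R _"] cong: if_cong)
      then show "\<exists>u. w k = (\<Sum>j\<in>S. u j *\<^sub>R w j) \<and> (\<forall>j\<in>S. 0 \<le> u j) \<and> sum u S = 1"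
        using assms k by (intro exI[of _ "\<lambda>j. if j = k then 1 else 0"]) auto
    qed
    show "convex ?R"
    proof (rule convexI, clarify)
      fix a b :: real and u v :: "'a \<Rightarrow> real"
      assume "0 \<le> a" "0 \<le> b" "a + b = 1" "\<forall>j\<in>S. 0 \<le> u j" "sum u S = 1" "\<forall>j\<in>S. 0 \<le> v j" "sum v S = 1"
      then show "\<exists>t. a *\<^sub>R (\<Sum>j\<in>S. u j *\<^sub>R w j) + b *\<^sub>R (\<Sum>j\<in>S. v j *\<^sub>R w j) = (\<Sum>j\<in>S. t j *\<^sub>R w j) \<and>
          (\<forall>j\<in>S. 0 \<le> t j) \<and> sum t S = 1"
        by (intro exI[of _ "\<lambda>j. a * u j + b * v j"])
          (simp add: scaleR_left_distrib scaleR_sum_right sum.distrib flip: sum_distrib_left)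
    qed
  qed
qed

text \<open>With \<open>w j0\<close> as origin, the remaining barycentric coordinates range over the
  standard simplex, of volume \<open>1 / fact (card (- K))\<close>. Taking \<open>j0\<close> in
  \<open>K\<close> makes the other vertices correspond to the columns outside
  \<open>K\<close>.\<close>

lemma measure_prism_simplex:
  fixes w :: "'n::finite \<Rightarrow> real^'n"
  assumes "j0 \<in> K" and det: "det (\<chi> r c. (if c \<in> K then axis c 1 else w c - w j0) $ r) \<noteq> 0"
    (is "det ?M \<noteq> 0")
  shows "measure lebesgue (prism K (convex hull (w ` insert j0 (- K))))
       = \<bar>det (\<chi> r c. (if c \<in> K then axis c 1 else w c - w j0) $ r)\<bar> / fact (card (- K))"
proof -
  define A where "A = {x. (\<forall>i\<in>-K. 0 \<le> x i) \<and> sum x (- K) \<le> (1::real)} \<inter> space (\<Pi>\<^sub>M i\<in>-K. lborel)"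
  have "A = {x \<in> space (\<Pi>\<^sub>M i\<in>-K. lborel). (\<forall>i\<in>-K. 0 \<le> x i) \<and> sum x (- K) \<le> 1}"
    by (auto simp: A_def)
  also have "\<dots> \<in> sets (\<Pi>\<^sub>M i\<in>-K. lborel)"
    by measurable
  finally have A: "A \<in> sets (\<Pi>\<^sub>M i\<in>-K. lborel)" .
  have sum_w: "(\<Sum>j\<in>insert j0 (- K). u j *\<^sub>R w j) = w j0 + (\<Sum>j\<in>-K. u j *\<^sub>R (w j - w j0))"
    if "sum u (insert j0 (- K)) = 1" for u
  proof -
    have "u j0 = 1 - sum u (- K)"
      using that \<open>j0 \<in> K\<close> by simp
    then show ?thesis
      using \<open>j0 \<in> K\<close> by (simp add: scaleR_left_diff_distrib scaleR_right_diff_distrib sum_subtractf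
          flip: scaleR_left.sum)
  qed
  have "convex hull (w ` insert j0 (- K)) = (\<lambda>x. w j0 + (\<Sum>j\<in>-K. x j *\<^sub>R (w j - w j0))) ` A"
  proof (intro equalityI subsetI)
    fix y assume "y \<in> convex hull (w ` insert j0 (- K))"
    then obtain u where u: "y = (\<Sum>j\<in>insert j0 (- K). u j *\<^sub>R w j)"
        "\<forall>j\<in>insert j0 (- K). 0 \<le> u j" "sum u (insert j0 (- K)) = 1"
      by (subst (asm) convex_hull_finite_image) auto
    have "restrict u (- K) \<in> A"
      using u(2,3) \<open>j0 \<in> K\<close> by (auto simp: A_def space_PiM)
    moreover have "y = w j0 + (\<Sum>j\<in>-K. restrict u (- K) j *\<^sub>R (w j - w j0))"
      unfolding u(1) sum_w[OF u(3)] by simp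
    ultimately show "y \<in> (\<lambda>x. w j0 + (\<Sum>j\<in>-K. x j *\<^sub>R (w j - w j0))) ` A"
      by blast
  next
    fix y assume "y \<in> (\<lambda>x. w j0 + (\<Sum>j\<in>-K. x j *\<^sub>R (w j - w j0))) ` A"
    then obtain x where x: "x \<in> A" "y = w j0 + (\<Sum>j\<in>-K. x j *\<^sub>R (w j - w j0))"
      by blast
    define u where "u = x(j0 := 1 - sum x (- K))"
    have eq: "sum u (- K) = sum x (- K)" "(\<Sum>j\<in>-K. u j *\<^sub>R (w j - w j0)) = (\<Sum>j\<in>-K. x j *\<^sub>R (w j - w j0))"
      using \<open>j0 \<in> K\<close> by (auto simp: u_def intro!: sum.cong)
    have u: "sum u (insert j0 (- K)) = 1"
      using \<open>j0 \<in> K\<close> by (simp add: eq) (simp add: u_def)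
    moreover have "\<forall>j\<in>insert j0 (- K). 0 \<le> u j"
      using x(1) by (auto simp: u_def A_def)
    moreover have "y = (\<Sum>j\<in>insert j0 (- K). u j *\<^sub>R w j)"
      unfolding sum_w[OF u] eq x(2) ..
    ultimately show "y \<in> convex hull (w ` insert j0 (- K))"
      by (subst convex_hull_finite_image) auto
  qed
  also have "\<dots> = (\<lambda>x. w j0 + (\<Sum>j\<in>-K. x j *\<^sub>R column (id j) ?M)) ` A"
    by (intro image_cong refl arg_cong2[of _ _ _ _ "(+)"] sum.cong) (auto simp: column_def vec_eq_iff)
  finally have hull: "convex hull (w ` insert j0 (- K)) = \<dots>" .
  have "measure lebesgue (prism K (convex hull (w ` insert j0 (- K))))
      = \<bar>det ?M\<bar> * measure (\<Pi>\<^sub>M i\<in>-K. lborel) A"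
  proof (rule measure_prism(2)[OF bij_betw_id _ det A _ hull])
    show "compact (convex hull (w ` insert j0 (- K)))"
      by (rule finite_imp_compact_convex_hull) simp
  qed (simp add: column_def vec_eq_iff)
  moreover have "measure (\<Pi>\<^sub>M i\<in>-K. lborel) A = 1 / fact (card (- K))"
    using emeasure_std_simplex_aux[of "- K" 1] by (simp add: A_def measure_def)
  ultimately show ?thesis
    by simp
qed

subsection \<open>Projections of the unit vectors along a sign vector\<close>

text \<open>The matrix determinant lemma, by turning on the rank-one terms row by row. Linearity in
  row \<open>k\<close> adds \<open>g $ k\<close> times a determinant whose row \<open>k\<close> is
  \<open>z\<close>.\<close>

lemma det_identity_plus_rank_one:
  fixes g z :: "'a::field^'n::finite"
  shows "det (\<chi> i. axis i 1 + g $ i *s z) = 1 + (\<Sum>i\<in>UNIV. g $ i * z $ i)"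
proof -
  have row_1: "row i (mat 1) = (axis i 1 :: 'a^'n)" for i
    by (auto simp: row_def mat_def axis_def vec_eq_iff)
  \<comment> \<open>Row \<open>k\<close> is \<open>z\<close>, so the terms in the rows of
    \<open>S\<close> are row operations; without them Cramer's rule for the identity gives
    \<open>z $ k\<close>.\<close>
  have replaced: "det (\<chi> i. if i = k then z else if i \<in> S then axis i 1 + g $ i *s z else axis i 1) = z $ k"
    if "k \<notin> S" for k S
    using finite[of S] that
  proof (induction S rule: finite_induct)
    case empty
    have "(\<Sum>i\<in>UNIV. z $ i *s axis i 1) = z"
      by (simp add: vec_eq_iff axis_def if_distrib cong: if_cong)
    then show ?case
      using cramer_lemma_transpose[of k z "mat 1"] by (simp add: row_1 cong: if_cong)
  next
    case (insert l S)
    define B where "B = (\<chi> i. if i = k then z else if i \<in> S then axis i 1 + g $ i *s z else axis i 1)"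
    have "(\<chi> i. if i = k then z else if i \<in> insert l S then axis i 1 + g $ i *s z else axis i 1)
        = (\<chi> i. if i = l then row l B + g $ l *s row k B else row i B)"
      using insert.hyps insert.prems by (auto simp: B_def row_def vec_eq_iff)
    then show ?case
      using insert det_row_operation[of l k B "g $ l"] by (auto simp: B_def)
  qed
  have "det (\<chi> i. if i \<in> S then axis i 1 + g $ i *s z else axis i 1) = 1 + (\<Sum>i\<in>S. g $ i * z $ i)" for S
    using finite[of S]
  proof (induction S rule: finite_induct)
    case empty
    have "(\<chi> i. axis i 1) = (mat 1 :: 'a^'n^'n)"
      by (auto simp: mat_def axis_def vec_eq_iff)
    then show ?case
      by simp
  next
    case (insert k S)
    define c where "c i = (if i \<in> S then axis i 1 + g $ i *s z else axis i 1)" for i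
    have "(\<chi> i. if i \<in> insert k S then axis i 1 + g $ i *s z else axis i 1)
        = (\<chi> i. if i = k then axis i 1 + g $ k *s z else c i)"
      by (auto simp: c_def vec_eq_iff)
    moreover have "(\<chi> i. if i = k then axis i 1 else c i) = (\<chi> i. c i)"
      using insert.hyps by (auto simp: c_def vec_eq_iff)
    ultimately show ?case
      using insert replaced[of k S] by (simp add: det_row_add det_row_mul c_def cong: if_cong)
  qed
  from this[of UNIV] show ?thesis
    by simp
qed

text \<open>For a sign vector \<open>s\<close> this is \<open>n\<close> times the projection of a unit vector to the complement of \<open>s\<close>.\<close>

definition projected_vertex :: "('n::finite \<Rightarrow> real) \<Rightarrow> 'n \<Rightarrow> real^'n" where
  "projected_vertex s j = real CARD('n) *\<^sub>R axis j 1 - s j *\<^sub>R (\<chi> i. s i)"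

lemma projected_vertex_nth:
  "projected_vertex s j $ i = (if i = j then real CARD('n) else 0) - s j * s i"
  for s :: "'n::finite \<Rightarrow> real"
  by (simp add: projected_vertex_def axis_def)

lemma det_projected_vertex_differences:
  fixes s :: "'n::finite \<Rightarrow> real"
  assumes "j0 \<in> K"
  shows "det (\<chi> r c. (if c \<in> K then axis c 1 else projected_vertex s c - projected_vertex s j0) $ r)
       = real CARD('n) ^ card (- K) * (1 - (\<Sum>c\<in>-K. s c * (s c - s j0)) / real CARD('n))"
    (is "det ?M = _")
proof -
  \<comment> \<open>The matrix factors as \<open>diag \<delta> (I + g z\<^sup>T) (I + e \<rho>\<^sup>T)\<close> with \<open>e\<close> the unit vector of \<open>j0\<close>.\<close>
  define n where "n = real CARD('n)"
  have "n \<noteq> 0"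
    by (simp add: n_def)
  define \<delta> where "\<delta> r = (if r \<in> K then 1 else n)" for r
  define g :: "real^'n" where "g = (\<chi> r. - s r / \<delta> r)"
  define z :: "real^'n" where "z = (\<chi> c. if c \<in> K then 0 else s c - s j0)"
  define \<rho> :: "real^'n" where "\<rho> = (\<chi> c. if c \<in> K then 0 else - n)"
  define G1 :: "real^'n^'n" where "G1 = (\<chi> i. axis i 1 + g $ i *s z)"
  define G2 :: "real^'n^'n" where "G2 = (\<chi> i. axis i 1 + axis j0 1 $ i *s \<rho>)"
  define B where "B = G1 ** G2"
  have G12: "B $ r $ c = axis r 1 $ c + g $ r * z $ c + axis j0 1 $ r * \<rho> $ c" for r c
  proof -
    have "B $ r $ c = (\<Sum>k\<in>UNIV. (axis r 1 $ k + g $ r * z $ k) * (axis k 1 $ c + axis j0 1 $ k * \<rho> $ c))"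
      by (simp add: B_def matrix_matrix_mult_def G1_def G2_def)
    also have "\<dots> = (\<Sum>k\<in>UNIV. (if k = r then axis k 1 $ c + axis j0 1 $ k * \<rho> $ c else 0)
        + (if k = c then g $ r * z $ k else 0) + (if k = j0 then g $ r * z $ k * \<rho> $ c else 0))"
      by (intro sum.cong refl) (auto simp: axis_def algebra_simps)
    also have "\<dots> = axis r 1 $ c + axis j0 1 $ r * \<rho> $ c + g $ r * z $ c + g $ r * z $ j0 * \<rho> $ c"
      by (simp add: sum.distrib)
    also have "z $ j0 = 0"
      using assms by (simp add: z_def)
    finally show ?thesis
      by simp
  qed
  have "?M = (\<chi> r. \<delta> r *s B $ r)"
    using assms \<open>n \<noteq> 0\<close>
    by (auto simp: vec_eq_iff G12 \<delta>_def g_def z_def \<rho>_def projected_vertex_nth axis_def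
        algebra_simps simp flip: n_def)
  then have "det ?M = prod \<delta> UNIV * det B"
    using det_rows_mul[of \<delta> "\<lambda>r. B $ r"] by simp
  also have "prod \<delta> UNIV = n ^ card (- K)"
    by (simp add: \<delta>_def prod.If_cases Compl_eq_Diff_UNIV flip: Compl_eq)
  also have "det B = (1 + (\<Sum>i\<in>UNIV. g $ i * z $ i)) * (1 + (\<Sum>i\<in>UNIV. axis j0 1 $ i * \<rho> $ i))"
    unfolding B_def det_mul G1_def G2_def det_identity_plus_rank_one ..
  \<comment> \<open>\<open>\<rho>\<close> vanishes at \<open>j0\<close>, so the second factor has
    determinant 1.\<close>
  also have "(\<Sum>i\<in>UNIV. axis j0 1 $ i * \<rho> $ i) = 0"
    using assms by (intro sum.neutral) (auto simp: axis_def \<rho>_def)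
  also have "(\<Sum>i\<in>UNIV. g $ i * z $ i) = (\<Sum>i\<in>-K. - (s i * (s i - s j0)) / n)"
    by (intro sum.mono_neutral_cong_right) (auto simp: g_def z_def \<delta>_def)
  also have "\<dots> = - (\<Sum>i\<in>-K. s i * (s i - s j0)) / n"
    by (simp add: sum_divide_distrib sum_negf)
  finally show ?thesis
    by (simp add: n_def)
qed

text \<open>\<open>H\<close> will be the affine hull of \<open>P\<close>. The coordinates of a
  projected vertex sum to \<open>n - s j * \<sigma>\<close>; for \<open>\<sigma> = 0\<close> this is
  the same \<open>n\<close> for every \<open>j\<close>, whence the second equation.\<close>

context
  fixes s :: "'n::finite \<Rightarrow> real" and n :: real and \<sigma> :: real and H :: "(real^'n) set" and P :: "(real^'n) set"
  assumes s: "\<And>j. s j = 1 \<or> s j = - 1"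
  defines "n \<equiv> real CARD('n)" and "\<sigma> \<equiv> sum s UNIV"
    and "H \<equiv> {x. (\<Sum>i\<in>UNIV. s i * x $ i) = 0 \<and> (\<sigma> = 0 \<longrightarrow> (\<Sum>i\<in>UNIV. x $ i) = n)}"
    and "P \<equiv> convex hull (range (projected_vertex s))"
begin

lemma sign_square: "s j * s j = 1"
  using s[of j] by auto

lemma sum_sign_squares: "(\<Sum>j\<in>UNIV. s j * s j) = n"
  by (simp add: sign_square n_def)

lemma n_pos: "n > 0"
  by (simp add: n_def)

lemma projected_vertex_combination_nth:
  "(\<Sum>j\<in>S. u j *\<^sub>R projected_vertex s j) $ i
     = (if i \<in> S then n * u i else 0) - s i * (\<Sum>j\<in>S. u j * s j)"
proof -
  have "(\<Sum>j\<in>S. u j *\<^sub>R projected_vertex s j) $ i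
      = (\<Sum>j\<in>S. (if i = j then n * u j else 0) - s i * (u j * s j))"
    by (auto simp: projected_vertex_nth n_def algebra_simps intro!: sum.cong)
  then show ?thesis
    by (simp add: sum_subtractf sum_distrib_left)
qed

section \<open>Affine hull and lattice of the projected polytope\<close>

lemma projected_vertex_in_H: "projected_vertex s j \<in> H"
proof -
  have "(\<Sum>i\<in>UNIV. s i * projected_vertex s j $ i) = (\<Sum>i\<in>UNIV. (if i = j then n * s j else 0) - s j * (s i * s i))"
    by (intro sum.cong refl) (auto simp: projected_vertex_nth n_def algebra_simps)
  moreover have "(\<Sum>i\<in>UNIV. projected_vertex s j $ i) = n - s j * \<sigma>"
    by (simp add: projected_vertex_nth n_def \<sigma>_def sum_subtractf flip: sum_distrib_left)
  ultimately show ?thesis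
    by (simp add: H_def sum_subtractf sum_sign_squares flip: sum_distrib_left)
qed

lemma projected_vertex_integral: "projected_vertex s j \<in> integer_points"
proof -
  have "s i \<in> \<int>" for i
    using s[of i] by auto
  then show ?thesis
    by (auto simp: integer_points_def projected_vertex_nth)
qed

lemma affine_H: "affine H"
proof -
  have "(\<Sum>i\<in>UNIV. s i * (u *\<^sub>R x + v *\<^sub>R y) $ i) = u * (\<Sum>i\<in>UNIV. s i * x $ i) + v * (\<Sum>i\<in>UNIV. s i * y $ i)"
    "(\<Sum>i\<in>UNIV. (u *\<^sub>R x + v *\<^sub>R y) $ i) = u * (\<Sum>i\<in>UNIV. x $ i) + v * (\<Sum>i\<in>UNIV. y $ i)"
    for u v and x y :: "real^'n"
    by (simp_all add: algebra_simps sum.distrib sum_distrib_left)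
  then show ?thesis
    unfolding affine_def H_def by (auto simp flip: distrib_right)
qed

lemma convex_hull_projected_vertices_subset_H: "convex hull (projected_vertex s ` S) \<subseteq> H"
  by (intro hull_minimal affine_imp_convex affine_H) (use projected_vertex_in_H in auto)

lemma affine_hull_P:
  assumes \<sigma>: "\<bar>\<sigma>\<bar> = 1 \<or> \<sigma> = 0"
  shows "affine hull P = H"
proof
  show "affine hull P \<subseteq> H"
    using convex_hull_projected_vertices_subset_H[of UNIV]
    by (intro hull_minimal affine_H) (simp add: P_def)
  show "H \<subseteq> affine hull P"
  proof
    fix x assume x: "x \<in> H"
    \<comment> \<open>Solving \<open>n * u j - \<tau> * s j = x $ j\<close> for the coefficients is
      consistent with \<open>\<tau>\<close> as their signed sum because \<open>x\<close> is
      orthogonal to \<open>s\<close>. Total weight 1 then means that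
      \<open>\<tau> * \<sigma>\<close> is \<open>n\<close> minus the coordinate sum of
      \<open>x\<close>: this \<open>\<tau>\<close> achieves it when \<open>\<sigma>\<close> is a
      sign, and for \<open>\<sigma> = 0\<close> it holds on \<open>H\<close>.\<close>
    define \<tau> where "\<tau> = \<sigma> * (n - (\<Sum>i\<in>UNIV. x $ i))"
    define u where "u j = (x $ j + \<tau> * s j) / n" for j
    have "\<tau> * \<sigma> = n - (\<Sum>i\<in>UNIV. x $ i)"
    proof (cases "\<sigma> = 0")
      case False
      then have "\<sigma> * \<sigma> = 1"
        using \<sigma> by (metis abs_mult_self_eq mult_1)
      then show ?thesis
        by (simp add: \<tau>_def mult.assoc mult.left_commute)
    qed (use x in \<open>simp add: H_def\<close>)
    then have sum_u: "sum u UNIV = 1"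
      using n_pos by (simp add: u_def sum.distrib \<sigma>_def flip: sum_divide_distrib sum_distrib_left)
    have "(\<Sum>j\<in>UNIV. u j * s j) = (\<Sum>j\<in>UNIV. s j * x $ j + \<tau> * (s j * s j)) / n"
      unfolding sum_divide_distrib by (intro sum.cong) (auto simp: u_def algebra_simps)
    also have "\<dots> = \<tau>"
      using x n_pos by (simp add: sum.distrib sum_sign_squares H_def flip: sum_distrib_left)
    finally have sum_us: "(\<Sum>j\<in>UNIV. u j * s j) = \<tau>" .
    have "n * u i = x $ i + \<tau> * s i" for i
      using n_pos by (simp add: u_def)
    then have "(\<Sum>j\<in>UNIV. u j *\<^sub>R projected_vertex s j) = x"
      unfolding vec_eq_iff projected_vertex_combination_nth sum_us by simp
    moreover have "(\<Sum>j\<in>UNIV. u j *\<^sub>R projected_vertex s j) \<in> affine hull P"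
      using sum_u
      by (intro affine_sum_image[OF affine_affine_hull]) (auto simp: P_def intro!: hull_inc)
    ultimately show "x \<in> affine hull P"
      by simp
  qed
qed

text \<open>The equation of the hyperplane has the unit \<open>s j\<close> as coefficient of
  \<open>x $ j\<close>, so it can be solved over the integers.\<close>

lemma integral_graph_odd:
  assumes "\<sigma> \<noteq> 0"
  shows "integral_graph {j} H"
proof -
  have int: "s i \<in> \<int>" for i
    using s[of i] by auto
  have "x \<in> H \<longleftrightarrow> x $ j = (\<Sum>i\<in>-{j}. - (s j * s i) * x $ i)" for x
  proof -
    have "(\<Sum>i\<in>UNIV. s i * x $ i) = s j * x $ j + (\<Sum>i\<in>-{j}. s i * x $ i)"
      by (subst sum.remove[of _ j]) (simp_all add: Compl_eq_Diff_UNIV)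
    moreover have "(\<Sum>i\<in>-{j}. - (s j * s i) * x $ i) = - s j * (\<Sum>i\<in>-{j}. s i * x $ i)"
      by (simp add: sum_distrib_left sum_negf mult.assoc)
    ultimately show ?thesis
      using assms s[of j] by (auto simp: H_def)
  qed
  then have "H = {x. \<forall>k\<in>{j}. x $ k = 0 + (\<Sum>i\<in>-{j}. - (s k * s i) * x $ i)}"
    by auto
  then show ?thesis
    unfolding integral_graph_def using int
    by (intro exI[of _ "\<lambda>_. 0"] exI[of _ "\<lambda>k i. - (s k * s i)"]) auto
qed

lemma card_positive:
  assumes "\<sigma> = 0"
  shows "2 * real (card {k. s k = 1}) = n"
proof -
  have "n = (\<Sum>i\<in>UNIV. 1 + s i)"
    using assms by (simp add: sum.distrib n_def \<sigma>_def)
  also have "\<dots> = (\<Sum>i\<in>UNIV. if i \<in> {k. s k = 1} then 2 else 0)"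
  proof (intro sum.cong refl)
    show "1 + s i = (if i \<in> {k. s k = 1} then 2 else 0)" for i
      using s[of i] by auto
  qed
  finally show ?thesis
    by (simp add: sum.If_cases)
qed

text \<open>Half the sum and half the difference of the two equations isolate \<open>x $ k\<close>
  and \<open>x $ j\<close>, as their signs are opposite. The coefficients are then 0 or -1, and the
  constant \<open>n / 2\<close> counts the positive signs.\<close>

lemma integral_graph_even:
  assumes "\<sigma> = 0" "s j = - 1" "s k = 1"
  shows "integral_graph {j, k} H"
proof -
  let ?K = "{j, k}"
  have "j \<noteq> k"
    using assms by auto
  have half: "n / 2 \<in> \<int>" "- (1 + s i * s l) / 2 \<in> \<int>" for i l
  proof -
    have "n / 2 = real (card {k. s k = 1})"
      using card_positive[OF assms(1)] by simp
    then show "n / 2 \<in> \<int>"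
      by simp
    have "- (1 + s i * s l) / 2 = 0 \<or> - (1 + s i * s l) / 2 = - 1"
      using s[of i] s[of l] by auto
    then show "- (1 + s i * s l) / 2 \<in> \<int>"
      by (metis Ints_0 Ints_1 Ints_minus)
  qed
  have "x \<in> H \<longleftrightarrow> (\<forall>l\<in>?K. x $ l = n / 2 + (\<Sum>i\<in>-?K. - (1 + s l * s i) / 2 * x $ i))" for x
  proof -
    define a where "a = (\<Sum>i\<in>-?K. x $ i)"
    define c where "c = (\<Sum>i\<in>-?K. s i * x $ i)"
    have split: "sum f UNIV = f j + f k + sum f (- ?K)" for f :: "'n \<Rightarrow> real"
    proof -
      have "sum f UNIV = sum f ?K + sum f (- ?K)"
        by (subst sum.union_disjoint [symmetric]) auto
      then show ?thesis
        using \<open>j \<noteq> k\<close> by simp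
    qed
    have sums: "(\<Sum>i\<in>UNIV. s i * x $ i) = x $ k - x $ j + c" "(\<Sum>i\<in>UNIV. x $ i) = x $ j + x $ k + a"
      unfolding split using assms by (simp_all add: a_def c_def)
    have coeff: "(\<Sum>i\<in>-?K. - (1 + s l * s i) / 2 * x $ i) = - (a + s l * c) / 2" for l
      unfolding a_def c_def sum_distrib_left sum.distrib [symmetric] sum_negf [symmetric] sum_divide_distrib
      by (intro sum.cong) (auto simp: algebra_simps)
    have "(\<forall>l\<in>?K. x $ l = n / 2 + (\<Sum>i\<in>-?K. - (1 + s l * s i) / 2 * x $ i)) \<longleftrightarrow>
        x $ j = n / 2 + - (a - c) / 2 \<and> x $ k = n / 2 + - (a + c) / 2"
      unfolding coeff using assms by simp
    moreover have "x \<in> H \<longleftrightarrow> x $ j = n / 2 + - (a - c) / 2 \<and> x $ k = n / 2 + - (a + c) / 2"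
      unfolding H_def mem_Collect_eq sums using assms(1) by (auto simp: field_simps)
    ultimately show ?thesis
      by (simp only:)
  qed
  then show ?thesis
    unfolding integral_graph_def using half
    by (intro exI[of _ "\<lambda>_. n / 2"] exI[of _ "\<lambda>l i. - (1 + s l * s i) / 2"]) auto
qed

section \<open>Volume of the projected polytope\<close>

lemma sum_sign_differences: "(\<Sum>c\<in>UNIV. s c * (s c - s j)) = n - s j * \<sigma>"
proof -
  have "(\<Sum>c\<in>UNIV. s c * (s c - s j)) = (\<Sum>c\<in>UNIV. s c * s c) - s j * \<sigma>"
    unfolding \<sigma>_def sum_distrib_left sum_subtractf [symmetric]
    by (intro sum.cong) (auto simp: algebra_simps)
  then show ?thesis
    by (simp add: sum_sign_squares)
qed

lemma hull_subset_hull_lattice: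
  "convex hull (projected_vertex s ` S) \<subseteq> convex hull (H \<inter> integer_points)"
  using projected_vertex_in_H projected_vertex_integral by (intro hull_mono) auto

lemma normalized_volume_odd:
  assumes "\<bar>\<sigma>\<bar> = 1" "CARD('n) \<ge> 2"
  shows "normalized_volume P = n ^ (CARD('n) - 2)"
proof -
  \<comment> \<open>Any index will do: its coordinate is thickened and its vertex becomes the base
    point of the simplex.\<close>
  obtain j :: 'n where True by blast
  let ?K = "{j}"
  have "integral_graph ?K H"
    using assms by (intro integral_graph_odd) auto
  then have graph: "integral_graph ?K (affine hull P)"
    using assms affine_hull_P by simp
  obtain p b where pb: "affine_lattice_iso (card (- ?K)) p b (affine hull P \<inter> integer_points)"
    and vol: "normalized_volume P = fact (card (- ?K)) * measure (\<Pi>\<^sub>M i\<in>{..<card (- ?K)}. lborel)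
           {x \<in> {..<card (- ?K)} \<rightarrow>\<^sub>E UNIV. affine_chart (card (- ?K)) p b x \<in> P}"
    using normalized_volume_integral_graph[OF graph] by blast
  have P: "compact P" "P \<subseteq> convex hull (affine hull P \<inter> integer_points)"
    using hull_subset_hull_lattice[of UNIV] affine_hull_P assms(1)
    by (simp_all add: P_def finite_imp_compact_convex_hull)
  have P_eq: "P = convex hull (projected_vertex s ` insert j (- ?K))"
    unfolding P_def by (rule arg_cong[of _ _ "\<lambda>A. convex hull (projected_vertex s ` A)"]) auto
  have "normalized_volume P = fact (card (- ?K)) * measure lebesgue (prism ?K P)"
    unfolding vol measure_affine_chart_vimage(2)[OF pb graph P] ..
  also have "\<dots> = \<bar>n ^ card (- ?K) * (1 - (\<Sum>c\<in>-?K. s c * (s c - s j)) / n)\<bar>"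
  proof -
    have "(\<Sum>c\<in>-?K. s c * (s c - s j)) = n - s j * \<sigma>"
      unfolding sum_sign_differences[symmetric] by (rule sum.mono_neutral_left) auto
    then have "1 - (\<Sum>c\<in>-?K. s c * (s c - s j)) / n \<noteq> 0"
      using n_pos assms(1) s[of j] by (auto simp: field_simps)
    then show ?thesis
      using det_projected_vertex_differences[of j ?K s] n_pos
        measure_prism_simplex[of j ?K "projected_vertex s"]
      unfolding P_eq by (simp add: n_def)
  qed
  also have "(\<Sum>c\<in>-?K. s c * (s c - s j)) = n - s j * \<sigma>"
    unfolding sum_sign_differences[symmetric] by (rule sum.mono_neutral_left) auto
  also have "\<bar>n ^ card (- ?K) * (1 - (n - s j * \<sigma>) / n)\<bar> = n ^ card (- ?K) / n"
  proof -
    have "1 - (n - s j * \<sigma>) / n = s j * \<sigma> / n"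
      using n_pos by (simp add: field_simps)
    moreover have "\<bar>s j * \<sigma>\<bar> = 1"
      using s[of j] assms(1) by (auto simp: abs_mult)
    ultimately show ?thesis
      using n_pos by (simp add: abs_mult)
  qed
  also have "\<dots> = n ^ (CARD('n) - 2)"
  proof -
    have "card (- ?K) = Suc (CARD('n) - 2)"
      using assms(2) by (simp add: Compl_eq_Diff_UNIV card_Diff_subset)
    then show ?thesis
      using n_pos by simp
  qed
  finally show ?thesis .
qed

text \<open>The vertices satisfy the single relation \<open>\<Sum>\<^sub>j s\<^sub>j v\<^sub>j = 0\<close>, whose coefficients sum to 0.
  Subtracting the largest admissible multiple of it from a convex combination makes the
  coefficient of some positive vertex vanish.\<close>

lemma hull_eq_Union_facets:
  assumes "\<sigma> = 0"
  shows "P = (\<Union>k\<in>{k. s k = 1}. convex hull (projected_vertex s ` (- {k})))" (is "_ = ?R")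
proof
  show "?R \<subseteq> P"
    unfolding P_def by (intro UN_least hull_mono) auto
  show "P \<subseteq> ?R"
  proof
    fix x assume "x \<in> P"
    then obtain u where x: "x = (\<Sum>j\<in>UNIV. u j *\<^sub>R projected_vertex s j)"
      and u: "\<And>j. 0 \<le> u j" "sum u UNIV = 1"
      unfolding P_def by (subst (asm) convex_hull_finite_image) auto
    have "{k. s k = 1} \<noteq> {}"
      using card_positive[OF assms] n_pos by (metis card.empty less_irrefl mult_zero_right of_nat_0)
    then have "Min (u ` {k. s k = 1}) \<in> u ` {k. s k = 1}"
      by (intro Min_in) auto
    then obtain k where "s k = 1" "u k = Min (u ` {k. s k = 1})"
      by auto
    then have k: "s k = 1" "\<And>l. s l = 1 \<Longrightarrow> u k \<le> u l"
      by auto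
    \<comment> \<open>A negative vertex gains weight and a positive one loses the least weight among
      positive vertices, so no coefficient turns negative.\<close>
    define t where "t j = u j - u k * s j" for j
    have t: "t k = 0" "\<And>j. 0 \<le> t j"
    proof -
      show "0 \<le> t j" for j
        using s[of j] k(2)[of j] u(1)[of j] u(1)[of k] by (auto simp: t_def)
    qed (simp add: t_def k(1))
    have "sum t UNIV = 1"
      using u(2) assms by (simp add: t_def sum_subtractf \<sigma>_def flip: sum_distrib_left)
    moreover have "sum t UNIV = sum t (- {k})"
      using t(1) by (intro sum.mono_neutral_right) auto
    ultimately have sum_t: "sum t (- {k}) = 1"
      by simp
    have "(\<Sum>j\<in>UNIV. s j *\<^sub>R projected_vertex s j) = 0"
      unfolding vec_eq_iff projected_vertex_combination_nth sum_sign_squares by simp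
    moreover have "(\<Sum>j\<in>UNIV. t j *\<^sub>R projected_vertex s j)
        = x - u k *\<^sub>R (\<Sum>j\<in>UNIV. s j *\<^sub>R projected_vertex s j)"
      unfolding x scaleR_sum_right sum_subtractf [symmetric]
      by (intro sum.cong) (simp_all add: t_def scaleR_left_diff_distrib)
    ultimately have "x = (\<Sum>j\<in>UNIV. t j *\<^sub>R projected_vertex s j)"
      by simp
    also have "\<dots> = (\<Sum>j\<in>-{k}. t j *\<^sub>R projected_vertex s j)"
      using t(1) by (intro sum.mono_neutral_right) auto
    finally have "x \<in> convex hull (projected_vertex s ` (- {k}))"
      using sum_t t(2) by (subst convex_hull_finite_image) auto
    then show "x \<in> ?R"
      using k(1) by blast
  qed
qed

lemma negligible_prism_Int:
  assumes "\<sigma> = 0" "s j = - 1" "s k = 1" "s l = 1" "k \<noteq> l"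
  shows "negligible (prism {j, k} (convex hull (projected_vertex s ` (- {k})) \<inter>
           convex hull (projected_vertex s ` (- {l}))))"
proof -
  \<comment> \<open>In a combination omitting \<open>k'\<close>, with both signs positive, the
    difference is minus \<open>n\<close> times the weight at \<open>l'\<close>, or zero if the
    indices agree. On an overlap the two inequalities force \<open>y $ k = y $ l\<close>.\<close>
  have difference: "y $ k' - y $ l' \<le> 0"
    if "y \<in> convex hull (projected_vertex s ` (- {k'}))" "s k' = 1" "s l' = 1" for y k' l'
  proof -
    obtain u where y: "y = (\<Sum>j\<in>-{k'}. u j *\<^sub>R projected_vertex s j)" and u: "\<And>j. j \<noteq> k' \<Longrightarrow> 0 \<le> u j"
      using \<open>y \<in> _\<close> by (subst (asm) convex_hull_finite_image) auto
    show ?thesis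
      unfolding y projected_vertex_combination_nth using u[of l'] n_pos that by auto
  qed
  \<comment> \<open>The functional \<open>a\<close> is constant on the points \<open>y\<close> of \<open>H\<close> with \<open>y\<^sub>k = y\<^sub>l\<close> and vanishes on the
    two directions of the prism.\<close>
  define a :: "real^'n" where "a = (\<chi> i. 1 + s i - 2 * axis k 1 $ i + 2 * axis l 1 $ i)"
  have "prism {j, k} (convex hull (projected_vertex s ` (- {k})) \<inter>
      convex hull (projected_vertex s ` (- {l}))) \<subseteq> {x. a \<bullet> x = n}"
  proof
    fix x assume "x \<in> prism {j, k} (convex hull (projected_vertex s ` (- {k})) \<inter>
      convex hull (projected_vertex s ` (- {l})))"
    then obtain y t where x: "x = y + t" and y: "y \<in> convex hull (projected_vertex s ` (- {k}))"
        "y \<in> convex hull (projected_vertex s ` (- {l}))"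
      and t: "t \<in> cbox 0 (\<chi> i. if i \<in> {j, k} then 1 else 0)"
      unfolding prism_def by blast
    have "y $ k = y $ l"
      using difference[OF y(1) assms(3,4)] difference[OF y(2) assms(4,3)] by simp
    moreover have "y \<in> H"
      using y(1) convex_hull_projected_vertices_subset_H by blast
    ultimately have "a \<bullet> y = n"
      using assms(1) by (simp add: a_def inner_vec_def axis_def algebra_simps sum.distrib sum_subtractf H_def
          if_distrib[of "\<lambda>c. _ * c"] cong: if_cong)
    moreover have "a \<bullet> t = 0"
    proof -
      have "t $ i = 0" if "i \<notin> {j, k}" for i
        using t that by (auto simp: mem_box_cart intro: antisym dest: spec[of _ i])
      then have "a $ i * t $ i = 0" for i
        using assms by (cases "i \<in> {j, k}") (auto simp: a_def axis_def)
      then show ?thesis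
        unfolding inner_vec_def inner_real_def by (intro sum.neutral) blast
    qed
    ultimately show "x \<in> {x. a \<bullet> x = n}"
      by (simp add: x inner_add_right)
  qed
  then show ?thesis
    using negligible_hyperplane[of a n] n_pos negligible_subset by blast
qed

text \<open>One lattice chart measures all pieces of the triangulation, while the piece omitting
  \<open>k\<close> is evaluated by thickening along \<open>{j, k}\<close>, with a fixed negative
  vertex \<open>j\<close> as base point. The pieces overlap in null sets, and each of the
  \<open>n / 2\<close> pieces has normalized volume \<open>2 * n ^ D / n\<close>.\<close>

lemma normalized_volume_even:
  assumes "\<sigma> = 0"
  shows "normalized_volume P = n ^ (CARD('n) - 2)"
proof -
  define S where "S = {k. s k = 1}"
  have card_S: "2 * real (card S) = n"
    using card_positive[OF assms] by (simp add: S_def)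
  then have "S \<noteq> {}"
    using n_pos by auto
  then obtain k0 where k0: "k0 \<in> S"
    by blast
  have "\<exists>j. s j = - 1"
  proof (rule ccontr)
    assume "\<nexists>j. s j = - 1"
    then have "\<sigma> = n"
      using s unfolding \<sigma>_def n_def by simp
    then show False
      using assms n_pos by simp
  qed
  then obtain j where j: "s j = - 1"
    by blast
  have j_ne: "j \<noteq> k" if "k \<in> S" for k
    using j that by (auto simp: S_def)
  define D where "D = card (- {j, k0})"
  have D: "card (- {j, k}) = D" if "k \<in> S" for k
    using j_ne[OF that] j_ne[OF k0] by (simp add: D_def Compl_eq_Diff_UNIV card_Diff_subset numeral_2_eq_2)
  have hull_P: "affine hull P = H"
    using assms by (intro affine_hull_P) simp
  have graph: "integral_graph {j, k} H" if "k \<in> S" for k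
    using that by (intro integral_graph_even assms j) (simp add: S_def)
  obtain p b where pb: "affine_lattice_iso D p b (H \<inter> integer_points)"
    and vol: "normalized_volume P = fact D * measure (\<Pi>\<^sub>M i\<in>{..<D}. lborel)
           {x \<in> {..<D} \<rightarrow>\<^sub>E UNIV. affine_chart D p b x \<in> P}"
    using normalized_volume_integral_graph[of "{j, k0}" P] graph[OF k0] unfolding D_def hull_P by blast
  define F where "F k = convex hull (projected_vertex s ` (- {k}))" for k
  define A where "A Q = {x \<in> {..<D} \<rightarrow>\<^sub>E UNIV. affine_chart D p b x \<in> Q}" for Q
  have F: "compact (F k)" "F k \<subseteq> convex hull (H \<inter> integer_points)" for k
    using hull_subset_hull_lattice by (simp_all add: F_def finite_imp_compact_convex_hull)
  have chart: "A Q \<in> fmeasurable (\<Pi>\<^sub>M i\<in>{..<D}. lborel)"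
    "measure (\<Pi>\<^sub>M i\<in>{..<D}. lborel) (A Q) = measure lebesgue (prism {j, k} Q)"
    if "k \<in> S" "compact Q" "Q \<subseteq> convex hull (H \<inter> integer_points)" for k Q
    using measure_affine_chart_vimage[of "{j, k}" p b H Q] pb graph that unfolding A_def D[OF that(1)]
    by blast+
  have F_vol: "fact D * measure lebesgue (prism {j, k} (F k)) = 2 * n ^ D / n" if "k \<in> S" for k
  proof -
    let ?K = "{j, k}"
    have "(\<Sum>c\<in>UNIV. s c * (s c - s j)) = (\<Sum>c\<in>?K. s c * (s c - s j)) + (\<Sum>c\<in>-?K. s c * (s c - s j))"
      by (subst sum.union_disjoint [symmetric]) auto
    \<comment> \<open>From the total \<open>n\<close> the term of \<open>j\<close> removes 0 and
      that of \<open>k\<close> removes 2.\<close>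
    then have sum: "(\<Sum>c\<in>-?K. s c * (s c - s j)) = n - 2"
      unfolding sum_sign_differences using assms j that j_ne[OF that] by (simp add: S_def)
    have "F k = convex hull (projected_vertex s ` insert j (- ?K))"
      unfolding F_def using j_ne[OF that]
      by (intro arg_cong[of _ _ "\<lambda>A. convex hull (projected_vertex s ` A)"]) auto
    moreover have "1 - (n - 2) / n = 2 / n"
      using n_pos by (simp add: field_simps)
    ultimately show ?thesis
      using det_projected_vertex_differences[of j ?K s] n_pos
        measure_prism_simplex[of j ?K "projected_vertex s"] D[OF that]
      unfolding n_def[symmetric] sum by (simp add: abs_mult)
  qed
  have "{x \<in> {..<D} \<rightarrow>\<^sub>E UNIV. affine_chart D p b x \<in> P} = (\<Union>k\<in>S. A (F k))"
    unfolding hull_eq_Union_facets[OF assms] by (auto simp: A_def S_def F_def)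
  then have "normalized_volume P = fact D * measure (\<Pi>\<^sub>M i\<in>{..<D}. lborel) (\<Union>k\<in>S. A (F k))"
    using vol by simp
  also have "measure (\<Pi>\<^sub>M i\<in>{..<D}. lborel) (\<Union>k\<in>S. A (F k))
      = (\<Sum>k\<in>S. measure (\<Pi>\<^sub>M i\<in>{..<D}. lborel) (A (F k)))"
  proof (rule measure_UNION_AE)
    show "A (F k) \<in> fmeasurable (\<Pi>\<^sub>M i\<in>{..<D}. lborel)" if "k \<in> S" for k
      using chart(1)[OF that F] .
    show "pairwise (\<lambda>k l. AE x in \<Pi>\<^sub>M i\<in>{..<D}. lborel. x \<notin> A (F k) \<or> x \<notin> A (F l)) S"
    proof (rule pairwiseI)
      fix k l assume kl: "k \<in> S" "l \<in> S" "k \<noteq> l"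
      have Q: "compact (F k \<inter> F l)" "F k \<inter> F l \<subseteq> convex hull (H \<inter> integer_points)"
        using F by (auto intro: compact_Int)
      have "negligible (prism {j, k} (F k \<inter> F l))"
        using kl unfolding F_def by (intro negligible_prism_Int assms j) (auto simp: S_def)
      then have "measure (\<Pi>\<^sub>M i\<in>{..<D}. lborel) (A (F k \<inter> F l)) = 0"
        using chart(2)[OF kl(1) Q] by (simp add: negligible_iff_measure)
      then have "A (F k \<inter> F l) \<in> null_sets (\<Pi>\<^sub>M i\<in>{..<D}. lborel)"
        using chart(1)[OF kl(1) Q] by (intro null_setsI fmeasurableD) (simp_all add: emeasure_eq_measure2)
      then show "AE x in \<Pi>\<^sub>M i\<in>{..<D}. lborel. x \<notin> A (F k) \<or> x \<notin> A (F l)"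
        by (rule AE_mp[OF AE_not_in]) (auto simp: A_def)
    qed
  qed simp
  also have "fact D * \<dots> = (\<Sum>k\<in>S. fact D * measure lebesgue (prism {j, k} (F k)))"
    using chart(2)[OF _ F] by (simp add: sum_distrib_left)
  also have "\<dots> = real (card S) * (2 * n ^ D / n)"
    by (simp add: F_vol)
  also have "\<dots> = n ^ D"
    using card_S n_pos by (simp add: field_simps)
  finally show ?thesis
    using j_ne[OF k0] by (simp add: D_def Compl_eq_Diff_UNIV card_Diff_subset numeral_2_eq_2)
qed

end

subsection \<open>The Laplacian of the boundary of a simplex\<close>

text \<open>The position of a vertex in the sorted list is the number of smaller vertices, which
  removes the list from the sign.\<close>

lemma boundary_coeff_eq:
  assumes "finite \<sigma>"
  shows "boundary_coeff \<tau> \<sigma> = (\<Sum>x\<in>\<sigma>. if \<tau> = \<sigma> - {x} then (- 1) ^ card {y \<in> \<sigma>. y < x} else 0)"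
proof -
  define l where "l = sorted_list_of_set \<sigma>"
  have l: "length l = card \<sigma>" "set l = \<sigma>" "distinct l" "sorted_wrt (<) l"
    using assms by (simp_all add: l_def)
  have nth: "bij_betw ((!) l) {..<card \<sigma>} \<sigma>"
    using l by (intro bij_betw_nth) auto
  have "bij_betw (\<lambda>k. k - 1) {1..card \<sigma>} {..<card \<sigma>}"
    by (rule bij_betw_byWitness[where f' = Suc]) auto
  from bij_betw_trans[OF this nth] have bij: "bij_betw (\<lambda>k. l ! (k - 1)) {1..card \<sigma>} \<sigma>"
    by (simp add: comp_def)
  have "card {y \<in> \<sigma>. y < l ! i} = i" if "i < card \<sigma>" for i
  proof -
    have "l ! m < l ! i \<longleftrightarrow> m < i" if "m < card \<sigma>" for m
      using sorted_wrt_nth_less[OF l(4), of m i] sorted_wrt_nth_less[OF l(4), of i m] that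
        \<open>i < card \<sigma>\<close> l(1) by (metis linorder_cases order_less_asym)
    then have "{m \<in> {..<card \<sigma>}. l ! m < l ! i} = {..<i}"
      using \<open>i < card \<sigma>\<close> by auto
    moreover have "{y \<in> (!) l ` {..<card \<sigma>}. y < l ! i} = (!) l ` {m \<in> {..<card \<sigma>}. l ! m < l ! i}"
      by blast
    ultimately have "{y \<in> \<sigma>. y < l ! i} = (!) l ` {..<i}"
      using nth by (simp add: bij_betw_def)
    moreover have "inj_on ((!) l) {..<i}"
      using l(1,3) that by (intro inj_on_nth) auto
    ultimately show ?thesis
      by (simp add: card_image)
  qed
  then show ?thesis
    unfolding boundary_coeff_def l_def[symmetric] sum.reindex_bij_betw[OF bij, symmetric]
    by (intro sum.cong) auto
qed

lemma boundary_coeff_facet: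
  assumes "finite \<sigma>" "x \<in> \<sigma>"
  shows "boundary_coeff (\<sigma> - {x}) \<sigma> = (- 1) ^ card {y \<in> \<sigma>. y < x}"
proof -
  have "(\<sigma> - {x} = \<sigma> - {y}) \<longleftrightarrow> y = x" if "y \<in> \<sigma>" for y
    using assms that by blast
  then have "boundary_coeff (\<sigma> - {x}) \<sigma> = (\<Sum>y\<in>\<sigma>. if y = x then (- 1) ^ card {z \<in> \<sigma>. z < y} else 0)"
    unfolding boundary_coeff_eq[OF assms(1)] by (intro sum.cong) auto
  then show ?thesis
    using assms by simp
qed

lemma boundary_coeff_eq_0:
  assumes "finite \<sigma>" "\<And>x. x \<in> \<sigma> \<Longrightarrow> \<tau> \<noteq> \<sigma> - {x}"
  shows "boundary_coeff \<tau> \<sigma> = 0"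
  unfolding boundary_coeff_eq[OF assms(1)] using assms(2) by (intro sum.neutral) auto

text \<open>There are no faces of dimension \<open>d + 1\<close>, so only the lower term remains. A
  facet has \<open>d + 1\<close> ridges, each contributing the square of a sign, and two distinct
  facets share the single ridge \<open>V - {a, b}\<close>. For \<open>d > 0\<close> the ridges are
  nonempty and do enter the sum.\<close>

lemma laplacian_simplex_boundary:
  fixes d :: nat
  defines "V \<equiv> {1..d + 2}"
  assumes "d > 0" and a: "a \<in> V" and b: "b \<in> V"
  shows "laplacian (std_simplex_boundary (d + 1)) (int d) (V - {a}) (V - {b})
       = (if a = b then int d + 1 else - ((- 1) ^ a * (- 1) ^ b))"
proof -
  have fin: "finite V" and card_V: "card V = d + 2"
    by (simp_all add: V_def)
  have \<Delta>: "std_simplex_boundary (d + 1) = Pow V - {V}"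
    by (simp add: std_simplex_boundary_def std_simplex_def V_def)
  have "\<sigma> = V" if "\<sigma> \<subseteq> V" "int (card \<sigma>) = int d + 1 + 1" for \<sigma>
    using that card_V by (intro card_subset_eq fin) auto
  then have top: "faces (Pow V - {V}) (int d + 1) = {}"
    by (auto simp: faces_def)
  define R where "R = faces (Pow V - {V}) (int d - 1)"
  have "R \<subseteq> Pow V"
    by (auto simp: R_def faces_def)
  then have "finite R"
    using fin by (auto intro: finite_subset)
  have R: "V - {x, y} \<in> R" if "x \<in> V" "y \<in> V" "x \<noteq> y" for x y
  proof -
    have "card (V - {x, y}) = d"
      using that fin by (subst card_Diff_subset) (auto simp: card_V)
    then show ?thesis
      using that \<open>d > 0\<close> by (auto simp: R_def faces_def)
  qed
  have lap: "laplacian (std_simplex_boundary (d + 1)) (int d) (V - {a}) (V - {b})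
      = (\<Sum>\<rho>\<in>R. boundary_coeff \<rho> (V - {a}) * boundary_coeff \<rho> (V - {b}))"
    unfolding laplacian_def \<Delta> top R_def by simp
  show ?thesis
  proof (cases "a = b")
    case True
    let ?F = "V - {a}"
    have "(\<Sum>\<rho>\<in>R. boundary_coeff \<rho> ?F * boundary_coeff \<rho> ?F)
        = (\<Sum>\<rho>\<in>(\<lambda>x. ?F - {x}) ` ?F. boundary_coeff \<rho> ?F * boundary_coeff \<rho> ?F)"
    proof (rule sum.mono_neutral_right[OF \<open>finite R\<close>])
      show "(\<lambda>x. ?F - {x}) ` ?F \<subseteq> R"
        using R[OF a] by (auto simp: Diff_insert2 [symmetric])
      show "\<forall>\<rho>\<in>R - (\<lambda>x. ?F - {x}) ` ?F. boundary_coeff \<rho> ?F * boundary_coeff \<rho> ?F = 0"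
        using boundary_coeff_eq_0[of ?F] fin by auto
    qed
    also have "\<dots> = (\<Sum>x\<in>?F. boundary_coeff (?F - {x}) ?F * boundary_coeff (?F - {x}) ?F)"
      by (subst sum.reindex) (auto simp: inj_on_def)
    also have "\<dots> = (\<Sum>x\<in>?F. 1)"
      using fin by (intro sum.cong refl) (simp add: boundary_coeff_facet flip: power_mult_distrib)
    also have "\<dots> = int d + 1"
      using a fin by (simp add: card_V)
    finally show ?thesis
      using lap True by simp
  next
    case False
    have "(\<Sum>\<rho>\<in>R. boundary_coeff \<rho> (V - {a}) * boundary_coeff \<rho> (V - {b}))
        = (\<Sum>\<rho>\<in>{V - {a, b}}. boundary_coeff \<rho> (V - {a}) * boundary_coeff \<rho> (V - {b}))"
    proof (rule sum.mono_neutral_right[OF \<open>finite R\<close>])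
      show "{V - {a, b}} \<subseteq> R"
        using R[OF a b False] by simp
      show "\<forall>\<rho>\<in>R - {V - {a, b}}. boundary_coeff \<rho> (V - {a}) * boundary_coeff \<rho> (V - {b}) = 0"
      proof (rule ballI, rule ccontr)
        fix \<rho> assume \<rho>: "\<rho> \<in> R - {V - {a, b}}"
          and "boundary_coeff \<rho> (V - {a}) * boundary_coeff \<rho> (V - {b}) \<noteq> 0"
        then obtain x y where "\<rho> = V - {a} - {x}" "\<rho> = V - {b} - {y}"
          using boundary_coeff_eq_0[of "V - {a}" \<rho>] boundary_coeff_eq_0[of "V - {b}" \<rho>] fin by auto
        then have "\<rho> = V - {a, b}"
          using False b by blast
        then show False
          using \<rho> by simp
      qed
    qed
    also have "\<dots> = boundary_coeff (V - {a} - {b}) (V - {a}) * boundary_coeff (V - {b} - {a}) (V - {b})"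
      by (simp add: Diff_insert2 [symmetric] insert_commute)
    also have "\<dots> = (- 1) ^ (card {y \<in> V - {a}. y < b} + card {y \<in> V - {b}. y < a})"
      using fin a b False by (simp add: boundary_coeff_facet power_add)
    also have "\<dots> = - ((- 1) ^ a * (- 1) ^ b)"
    proof -
      \<comment> \<open>Deleting a smaller vertex lowers the position by one. Exactly one of the two
        positions is affected, so the exponents add up to \<open>a + b - 3\<close>, which gives the
        minus sign.\<close>
      have below: "card {y \<in> V - {x}. y < z} = (if x < z then z - 2 else z - 1)"
        if "x \<in> V" "z \<in> V" for x z
      proof -
        have "{y \<in> V - {x}. y < z} = {1..<z} - {x}"
          using that by (auto simp: V_def)
        moreover have "1 \<le> x"
          using that by (simp add: V_def)
        ultimately show ?thesis
          by (simp add: card_Diff_singleton_if numeral_2_eq_2)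
      qed
      have "even (card {y \<in> V - {a}. y < b} + card {y \<in> V - {b}. y < a}) \<longleftrightarrow> odd (a + b)"
      proof -
        have "odd (x + z) \<longleftrightarrow> even (z - 2 + (x - 1))" if "1 \<le> x" "x < z" for x z :: nat
          using that by presburger
        then show ?thesis
          unfolding below[OF a b] below[OF b a] using False a b
          by (cases "a < b") (auto simp: V_def add.commute)
      qed
      then show ?thesis
        by (auto simp: minus_one_power_iff simp flip: power_add)
    qed
    finally show ?thesis
      using lap False by simp
  qed
qed

lemma sum_alternating_signs: "(\<Sum>a = 1..m. (- 1) ^ a :: real) = (if even m then 0 else - 1)"
  by (induction m) auto

text \<open>A point is a graph with all coordinates dependent, so \<open>K\<close> is
  \<open>UNIV\<close> and the chart is constant. The product measure over the empty index set is a
  unit point mass.\<close>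

lemma normalized_volume_origin: "normalized_volume {0 :: real^'n::finite} = 1"
proof -
  have "integral_graph UNIV {0 :: real^'n}"
    unfolding integral_graph_def
    by (intro exI[of _ "\<lambda>_. 0"] exI[of _ "\<lambda>_ _. 0"]) (auto simp: vec_eq_iff)
  then have "integral_graph UNIV (affine hull {0 :: real^'n})"
    by simp
  then obtain p b where pb: "affine_lattice_iso (card (- (UNIV :: 'n set))) p b
      (affine hull {0 :: real^'n} \<inter> integer_points)"
    and vol: "normalized_volume {0 :: real^'n}
      = fact (card (- (UNIV :: 'n set))) * measure (\<Pi>\<^sub>M i\<in>{..<card (- (UNIV :: 'n set))}. lborel)
           {x \<in> {..<card (- (UNIV :: 'n set))} \<rightarrow>\<^sub>E UNIV.
             affine_chart (card (- (UNIV :: 'n set))) p b x \<in> {0}}"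
    by (rule normalized_volume_integral_graph)
  have "p = 0"
    using pb by (auto simp: affine_lattice_iso_def bij_betw_def affine_chart_def)
  then show ?thesis
    unfolding vol by (simp add: affine_chart_def PiM_empty measure_count_space)
qed

theorem corollary6p7:
  fixes d :: nat and pos :: "'n::finite \<Rightarrow> nat"
  assumes "bij_betw pos UNIV {1..d + 2}"
  shows "normalized_volume
           (laplacian_polytope (std_simplex_boundary (d + 1)) (int d)
             (\<lambda>r. boundary_facet d (pos r)))
         = real ((d + 2) ^ d)"
proof (cases "d = 0")
  case True
  \<comment> \<open>For \<open>d = 0\<close> the only edge is removed from the complex and the empty
    face is not counted, so both sums in the Laplacian are empty.\<close>
  have "faces (std_simplex_boundary 1) 1 = {}" "faces (std_simplex_boundary 1) (- 1) = {}"
  proof -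
    have "\<sigma> = {1..2}" if "\<sigma> \<subseteq> {1..2::nat}" "card \<sigma> = 2" for \<sigma>
      using that by (intro card_subset_eq) auto
    then show "faces (std_simplex_boundary 1) 1 = {}" "faces (std_simplex_boundary 1) (- 1) = {}"
      by (auto simp: faces_def std_simplex_boundary_def std_simplex_def numeral_2_eq_2)
  qed
  then have "laplacian_matrix (std_simplex_boundary (d + 1)) (int d) (\<lambda>r. boundary_facet d (pos r)) = 0"
    by (simp add: True laplacian_matrix_def laplacian_def vec_eq_iff)
  then have "laplacian_polytope (std_simplex_boundary (d + 1)) (int d) (\<lambda>r. boundary_facet d (pos r)) = {0}"
    by (auto simp: laplacian_polytope_def columns_def column_def zero_vec_def)
  then show ?thesis
    by (simp add: True normalized_volume_origin)
next
  case False
  have card_n: "CARD('n) = d + 2"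
    using bij_betw_same_card[OF assms] by simp
  \<comment> \<open>The vertex missing from the facet at position \<open>pos r\<close>. The reversal
    \<open>d + 3 - k\<close> permutes the vertices, so \<open>a\<close> is again a
    bijection.\<close>
  define a where "a r = d + 3 - pos r" for r
  have "bij_betw (\<lambda>k. d + 3 - k) {1..d + 2} {1..d + 2}"
    by (rule bij_betw_byWitness[where f' = "\<lambda>k. d + 3 - k"]) auto
  from bij_betw_trans[OF assms this] have a: "bij_betw a UNIV {1..d + 2}"
    by (simp add: a_def[abs_def] comp_def)
  then have a_in: "a r \<in> {1..d + 2}" and a_inj: "a r = a c \<longleftrightarrow> r = c" for r c
    by (auto simp: bij_betw_def inj_on_def)
  define s :: "'n \<Rightarrow> real" where "s r = (- 1) ^ a r" for r
  have s: "s r = 1 \<or> s r = - 1" for r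
    by (simp add: s_def minus_one_power_iff)
  have "sum s UNIV = (\<Sum>k = 1..d + 2. (- 1) ^ k)"
    unfolding s_def by (rule sum.reindex_bij_betw[OF a])
  then have sum_s: "sum s UNIV = (if even d then 0 else - 1)"
    unfolding sum_alternating_signs by simp
  have "column c (laplacian_matrix (std_simplex_boundary (d + 1)) (int d) (\<lambda>r. boundary_facet d (pos r)))
      = projected_vertex s c" for c
  proof -
    have "real_of_int (laplacian (std_simplex_boundary (d + 1)) (int d)
        (boundary_facet d (pos r)) (boundary_facet d (pos c)))
        = (if r = c then real d + 1 else - (s r * s c))" for r
      using laplacian_simplex_boundary[OF _ a_in a_in, of r c] False a_inj[of r c]
      by (simp add: boundary_facet_def a_def s_def)
    \<comment> \<open>The diagonal entry \<open>d + 1\<close> equals \<open>n - s c * s c\<close>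
      with \<open>n = d + 2\<close>.\<close>
    moreover have "s c * s c = 1"
      using s[of c] by auto
    ultimately show ?thesis
      by (auto simp: vec_eq_iff column_def laplacian_matrix_def projected_vertex_nth card_n)
  qed
  then have "laplacian_polytope (std_simplex_boundary (d + 1)) (int d) (\<lambda>r. boundary_facet d (pos r))
      = convex hull (range (projected_vertex s))"
    by (auto simp: laplacian_polytope_def columns_def intro!: arg_cong[of _ _ "(hull) convex"])
  moreover have "normalized_volume (convex hull (range (projected_vertex s))) = real CARD('n) ^ (CARD('n) - 2)"
  proof (cases "even d")
    case True
    then show ?thesis
      using normalized_volume_even[of s, OF s] sum_s by simp
  next
    case False
    then show ?thesis
      using normalized_volume_odd[of s, OF s] sum_s card_n by simp
  qed
  ultimately show ?thesis
    by (simp add: card_n)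
qed

end
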